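(* Let $\alpha,\beta,\gamma,\delta,\kappa$ be positive integers with $0<\gamma+\delta\le\beta+\kappa$ and $\kappa\le\min(\alpha,\gamma)$. Then there is a $\mathbb{Z}_3\mathbb{Z}_9$-linear code $C$ of type $(\alpha,\beta;\gamma,\delta;\kappa)$ with $\mathrm{rank}(C)=r$ if and only if $$r\in\left\{\gamma+2\delta,\ldots,\min\left(\beta+\delta+\kappa,\ \gamma+\delta+\binom{\delta+1}{2}+\binom{\delta+2}{3}\right)\right\}.$$
   Context: A $\mathbb{Z}_3\mathbb{Z}_9$-additive code $\mathcal{C}$ is a subgroup of $\mathbb{Z}_3^\alpha\times\mathbb{Z}_9^\beta$. As an abelian group $\mathcal{C}\cong\mathbb{Z}_3^\gamma\times\mathbb{Z}_9^\delta$; if $\kappa$ is the $\mathbb{Z}_3$-dimension of the projection onto the first $\alpha$ coordinates of the subcode of codewords of order dividing $3$, then $\mathcal{C}$ has type $(\alpha,\beta;\gamma,\delta;\kappa)$. The Gray map $\phi:\mathbb{Z}_9\to\mathbb{Z}_3^3$ is $\phi(\theta)=\theta''(1,1,1)+\theta'(0,1,2)$ for $\theta=3\theta''+\theta'$, $\theta',\theta''\in\{0,1,2\}$, and $\Phi(\mathbf{x},\mathbf{y})=(\mathbf{x},\phi(y_1),\ldots,\phi(y_\beta))$. A $\mathbb{Z}_3\mathbb{Z}_9$-linear code of type $(\alpha,\beta;\gamma,\delta;\kappa)$ is $C=\Phi(\mathcal{C})$ for such a $\mathcal{C}$. $\mathrm{rank}(C)$ is the dimension over $\mathbb{Z}_3$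 of the linear span of $C$. *)

theory Defs
  imports Main
begin

definition Z3Z9_space :: "nat \<Rightarrow> nat \<Rightarrow> (int list \<times> int list) set" where
  "Z3Z9_space a b = {(x, y). length x = a \<and> length y = b \<and>
      set x \<subseteq> {0..2} \<and> set y \<subseteq> {0..8}}"

definition z39_add :: "int list \<times> int list \<Rightarrow> int list \<times> int list \<Rightarrow> int list \<times> int list" where
  "z39_add u v = (map2 (\<lambda>a b. (a + b) mod 3) (fst u) (fst v),
                  map2 (\<lambda>a b. (a + b) mod 9) (snd u) (snd v))"

definition z39_neg :: "int list \<times> int list \<Rightarrow> int list \<times> int list" where
  "z39_neg u = (map (\<lambda>a. (- a) mod 3) (fst u), map (\<lambda>a. (- a) mod 9) (snd u))"

definition z39_zero :: "nat \<Rightarrow> nat \<Rightarrow> int list \<times> int list" where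
  "z39_zero a b = (replicate a 0, replicate b 0)"

definition additive_code :: "nat \<Rightarrow> nat \<Rightarrow> (int list \<times> int list) set \<Rightarrow> bool" where
  "additive_code a b C \<longleftrightarrow> C \<subseteq> Z3Z9_space a b \<and> z39_zero a b \<in> C \<and>
     (\<forall>u\<in>C. \<forall>v\<in>C. z39_add u v \<in> C) \<and> (\<forall>u\<in>C. z39_neg u \<in> C)"

definition f3_add :: "int list \<Rightarrow> int list \<Rightarrow> int list" where
  "f3_add v w = map2 (\<lambda>a b. (a + b) mod 3) v w"

definition f3_smult :: "int \<Rightarrow> int list \<Rightarrow> int list" where
  "f3_smult c v = map (\<lambda>a. (c * a) mod 3) v"

inductive_set f3_span :: "nat \<Rightarrow> int list set \<Rightarrow> int list set" for n :: nat and S :: "int list set" where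
  zero: "replicate n 0 \<in> f3_span n S"
| comb: "v \<in> S \<Longrightarrow> c \<in> {0..2} \<Longrightarrow> w \<in> f3_span n S \<Longrightarrow> f3_add (f3_smult c v) w \<in> f3_span n S"

definition f3_dim :: "nat \<Rightarrow> int list set \<Rightarrow> nat" where
  "f3_dim n V = (LEAST k. \<exists>B. finite B \<and> card B = k \<and> B \<subseteq> V \<and> f3_span n B = V)"

definition code_type :: "nat \<Rightarrow> nat \<Rightarrow> nat \<Rightarrow> nat \<Rightarrow> nat \<Rightarrow> (int list \<times> int list) set \<Rightarrow> bool" where
  "code_type a b g d k C \<longleftrightarrow> additive_code a b C \<and>
     (\<exists>f. bij_betw f (Z3Z9_space g d) C \<and>
          (\<forall>u\<in>Z3Z9_space g d. \<forall>v\<in>Z3Z9_space g d. f (z39_add u v) = z39_add (f u) (f v))) \<and>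
     f3_dim a {x. \<exists>y. (x, y) \<in> C \<and> z39_add (x, y) (z39_add (x, y) (x, y)) = z39_zero a b} = k"

definition gray :: "int \<Rightarrow> int list" where
  "gray t = (let t2 = t div 3; t1 = t mod 3 in
             [t2 mod 3, (t2 + t1) mod 3, (t2 + 2 * t1) mod 3])"

definition Gray :: "int list \<times> int list \<Rightarrow> int list" where
  "Gray u = fst u @ concat (map gray (snd u))"

definition code_rank :: "nat \<Rightarrow> nat \<Rightarrow> (int list \<times> int list) set \<Rightarrow> nat" where
  "code_rank a b C = f3_dim (a + 3 * b) (f3_span (a + 3 * b) (Gray ` C))"

end

theory Submission
  imports Defs "HOL-Number_Theory.Cong" "HOL-Library.FuncSet"
begin

text \<open>
  Up to an injective linear map, the Gray image of a codeword consists of its ternary coordinates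
  together with the low and the high ternary digits of its \<open>\<int>\<^sub>9\<close>-coordinates, so the rank is the
  dimension of the space of functions on the code spanned by these digits. All dimensions are read
  off from cardinalities of subspaces.

  The ternary coordinates and the low digits span a space of dimension \<open>\<delta> + \<kappa>\<close>, and there are \<open>\<beta>\<close>
  high digits. On the other hand, addition in \<open>\<int>\<^sub>9\<close> has the carry \<open>- s t (s + t + 1)\<close> modulo 3, so in
  terms of generators every digit is a combination of the \<open>\<gamma>\<close> free coordinates, the \<open>\<delta>\<close> high digits
  of the \<open>\<int>\<^sub>9\<close>-parameters \<open>\<mu>\<close> and the reduced monomials of degree 1 to 3 in \<open>\<mu>\<close>. This gives both
  upper bounds; the lower bound holds because the Gray map is injective.

  Conversely, there is a family of integral linear forms in \<open>\<mu>\<close>, as many as there are such functions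
  of \<open>\<mu>\<close>, whose high digits are linearly independent. Appending any \<open>t\<close> of them (other than those that are already
  present) as \<open>\<int>\<^sub>9\<close>-coordinates to the trivial code of the given type raises the rank by exactly \<open>t\<close>.
\<close>

subsection \<open>Dimension and cardinality over the field with three elements\<close>

text \<open>The vectors (1,1,1) and (0,1,2) of the Gray map are independent over F_3, so digits
  carry the same linear information as the Gray image, and the carry is the only nonlinearity left.
  A generator of order 3 meets the coordinates modulo 9 in multiples of 3; adding those produces no
  carry, so the free parameters enter linearly. Only the parameters \<mu> interact. Each carry is a
  cubic polynomial evaluated at linear forms, so degree 3 is never exceeded. The forms used for the
  converse have the exponent vectors of the monomials as coefficients, e.g. 2 \<mu>_i + \<mu>_j for
  \<mu>_i^2 \<mu>_j. Their high digits are not the monomials themselves, so independence needs its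
  own proof: messages with at most three nonzero parameters split the relations into small
  invertible systems modulo 3. \<open>f3_dim\<close> is the least size of a spanning set, which
  makes lower bounds hard to reach directly. Hence counting replaces bases, and independence of
  coordinate functions is expressed dually: a subspace whose annihilator is trivial is the whole
  space.\<close>

definition f3_vecs :: "nat \<Rightarrow> int list set" where
  "f3_vecs n = {v. length v = n \<and> set v \<subseteq> {0..2}}"

definition f3_subspace :: "nat \<Rightarrow> int list set \<Rightarrow> bool" where
  "f3_subspace n V \<longleftrightarrow> V \<subseteq> f3_vecs n \<and> replicate n 0 \<in> V \<and> (\<forall>v\<in>V. \<forall>w\<in>V. f3_add v w \<in> V)"

lemma f3_vecs_iff_nth: "v \<in> f3_vecs n \<longleftrightarrow> length v = n \<and> (\<forall>i<n. 0 \<le> v ! i \<and> v ! i < 3)"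
  by (force simp: f3_vecs_def set_conv_nth subset_iff)

lemma finite_f3_vecs [simp]: "finite (f3_vecs n)"
  and card_f3_vecs: "card (f3_vecs n) = 3 ^ n"
  using finite_lists_length_eq[of "{0..2::int}" n] card_lists_length_eq[of "{0..2::int}" n]
  by (simp_all add: f3_vecs_def conj_commute)

lemma length_f3_add [simp]: "length (f3_add v w) = min (length v) (length w)"
  by (simp add: f3_add_def)

lemma nth_f3_add [simp]:
  "i < length v \<Longrightarrow> i < length w \<Longrightarrow> f3_add v w ! i = (v ! i + w ! i) mod 3"
  by (simp add: f3_add_def)

lemma length_f3_smult [simp]: "length (f3_smult c v) = length v"
  by (simp add: f3_smult_def)

lemma nth_f3_smult [simp]: "i < length v \<Longrightarrow> f3_smult c v ! i = (c * v ! i) mod 3"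
  by (simp add: f3_smult_def)

lemma f3_add_in_vecs: "v \<in> f3_vecs n \<Longrightarrow> w \<in> f3_vecs n \<Longrightarrow> f3_add v w \<in> f3_vecs n"
  by (simp add: f3_vecs_iff_nth)

lemma f3_smult_in_vecs: "v \<in> f3_vecs n \<Longrightarrow> f3_smult c v \<in> f3_vecs n"
  by (simp add: f3_vecs_iff_nth)

lemma f3_add_assoc: "f3_add (f3_add u v) w = f3_add u (f3_add v w)"
  by (rule nth_equalityI) (auto simp: mod_simps add.assoc)

lemma f3_add_zero: "w \<in> f3_vecs n \<Longrightarrow> f3_add (replicate n 0) w = w"
  by (rule nth_equalityI) (auto simp: f3_vecs_iff_nth)

lemma zero_in_f3_vecs: "replicate n 0 \<in> f3_vecs n"
  by (simp add: f3_vecs_iff_nth)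

text \<open>Scalars of F_3 are repeated sums, so additive closure already yields scalar
  multiples.\<close>

lemma f3_subspace_smult:
  assumes "f3_subspace n V" "v \<in> V" "c \<in> {0..2}"
  shows "f3_smult c v \<in> V"
proof -
  have v: "v \<in> f3_vecs n" using assms by (auto simp: f3_subspace_def)
  consider "c = 0" | "c = 1" | "c = 2" using assms(3) by fastforce
  then show ?thesis
  proof cases
    case 1
    then have "f3_smult c v = replicate n 0"
      using v by (intro nth_equalityI) (auto simp: f3_vecs_iff_nth)
    then show ?thesis using assms by (simp add: f3_subspace_def)
  next
    case 2
    then have "f3_smult c v = v"
      using v by (intro nth_equalityI) (auto simp: f3_vecs_iff_nth)
    then show ?thesis using assms by simp
  next
    case 3
    then have "f3_smult c v = f3_add v v"
      by (intro nth_equalityI) auto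
    then show ?thesis using assms by (simp add: f3_subspace_def)
  qed
qed

lemma f3_span_subset:
  assumes "f3_subspace n V" "S \<subseteq> V"
  shows "f3_span n S \<subseteq> V"
proof
  fix v assume "v \<in> f3_span n S"
  then show "v \<in> V"
  proof induction
    case zero
    then show ?case using assms by (simp add: f3_subspace_def)
  next
    case (comb v c w)
    then show ?case using assms f3_subspace_smult[OF assms(1), of v c]
      by (auto simp: f3_subspace_def)
  qed
qed

lemma f3_subspace_vecs: "f3_subspace n (f3_vecs n)"
  by (simp add: f3_subspace_def f3_add_in_vecs zero_in_f3_vecs)

lemma f3_span_subspace:
  assumes "S \<subseteq> f3_vecs n"
  shows "f3_subspace n (f3_span n S)"
proof -
  have sub: "f3_span n S \<subseteq> f3_vecs n"
    by (rule f3_span_subset[OF f3_subspace_vecs assms])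
  have "f3_add v w \<in> f3_span n S" if "v \<in> f3_span n S" and w: "w \<in> f3_span n S" for v w
    using that(1)
  proof induction
    case zero
    then show ?case using w sub f3_add_zero by auto
  next
    case (comb v c u)
    then show ?case by (simp add: f3_add_assoc f3_span.comb)
  qed
  then show ?thesis using sub by (simp add: f3_subspace_def f3_span.zero)
qed

lemma f3_span_superset:
  assumes "S \<subseteq> f3_vecs n"
  shows "S \<subseteq> f3_span n S"
proof
  fix v assume v: "v \<in> S"
  then have "f3_add (f3_smult 1 v) (replicate n 0) = v"
    using assms by (intro nth_equalityI) (auto simp: f3_vecs_iff_nth subset_iff)
  then show "v \<in> f3_span n S"
    using f3_span.comb[OF v, of 1 "replicate n 0" n] by (simp add: f3_span.zero)
qed

text \<open>The inductive span may use the same generator many times; collecting the multiples of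
  \<open>v\<close> into one coefficient modulo 3 lets the span be counted one generator at a
  time.\<close>

lemma f3_span_insert:
  assumes "insert v B \<subseteq> f3_vecs n"
  shows "f3_span n (insert v B) = (\<lambda>(c, w). f3_add (f3_smult c v) w) ` ({0..2} \<times> f3_span n B)"
    (is "_ = ?R")
proof (rule antisym)
  have v: "v \<in> f3_vecs n" and B: "B \<subseteq> f3_vecs n" using assms by auto
  note spB = f3_span_subspace[OF B]
  have 0: "f3_add (f3_smult 0 v) w = w" if "w \<in> f3_span n B" for w
    using that spB v
    by (intro nth_equalityI) (auto simp: f3_subspace_def f3_vecs_iff_nth subset_iff)
  have spR: "f3_subspace n ?R"
    unfolding f3_subspace_def
  proof (intro conjI ballI)
    show "?R \<subseteq> f3_vecs n"
      using spB v by (auto simp: f3_subspace_def intro!: f3_add_in_vecs f3_smult_in_vecs)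
    show "replicate n 0 \<in> ?R"
      using 0[OF f3_span.zero] f3_span.zero[of n B] by (force simp: image_iff)
    fix x y assume "x \<in> ?R" "y \<in> ?R"
    then obtain c w c' w' where *: "x = f3_add (f3_smult c v) w" "y = f3_add (f3_smult c' v) w'"
      "w \<in> f3_span n B" "w' \<in> f3_span n B" by auto
    have "f3_add x y = f3_add (f3_smult ((c + c') mod 3) v) (f3_add w w')"
      unfolding * by (rule nth_equalityI) (simp, simp add: mod_simps, simp add: algebra_simps)
    moreover have "f3_add w w' \<in> f3_span n B" using spB * by (auto simp: f3_subspace_def)
    moreover have "(c + c') mod 3 \<in> {0..2}"
      using pos_mod_bound[of 3 "c + c'"] by (simp del: pos_mod_bound)
    ultimately show "f3_add x y \<in> ?R"
      by (intro image_eqI[of _ _ "((c + c') mod 3, f3_add w w')"]) auto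
  qed
  show "f3_span n (insert v B) \<subseteq> ?R"
  proof (rule f3_span_subset[OF spR])
    have "B \<subseteq> ?R"
      using 0 f3_span_superset[OF B] by (force simp: image_iff)
    moreover have "f3_add (f3_smult 1 v) (replicate n 0) = v"
      using v by (intro nth_equalityI) (auto simp: f3_vecs_iff_nth)
    then have "v \<in> ?R"
      using f3_span.zero[of n B] by (intro image_eqI[of _ _ "(1, replicate n 0)"]) auto
    ultimately show "insert v B \<subseteq> ?R" by auto
  qed
  note sp = f3_span_subspace[OF assms]
  have "f3_span n B \<subseteq> f3_span n (insert v B)"
    using f3_span_superset[OF assms] by (intro f3_span_subset[OF sp]) auto
  then show "?R \<subseteq> f3_span n (insert v B)"
    by (auto intro: f3_span.comb)
qed

lemma card_f3_span_le:
  assumes "finite B" "B \<subseteq> f3_vecs n"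
  shows "card (f3_span n B) \<le> 3 ^ card B"
  using assms
proof (induction B)
  case empty
  have "f3_span n {} \<subseteq> {replicate n 0}"
    by (rule f3_span_subset) (auto simp: f3_subspace_def zero_in_f3_vecs f3_add_zero)
  then have "card (f3_span n {}) \<le> card {replicate n (0::int)}" by (intro card_mono) auto
  then show ?case by simp
next
  case (insert v B)
  have fin: "finite (f3_span n B)"
    using f3_span_subspace[of B n] insert.prems
    by (auto simp: f3_subspace_def intro: finite_subset[OF _ finite_f3_vecs])
  have "card (f3_span n (insert v B)) \<le> card ({0..2::int} \<times> f3_span n B)"
    unfolding f3_span_insert[OF insert.prems] using fin by (intro card_image_le) auto
  also have "\<dots> \<le> 3 * 3 ^ card B"
    using insert by (simp add: card_cartesian_product)
  finally show ?case using insert.hyps by simp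
qed

text \<open>Two representations with different coefficients of \<open>v\<close> could be solved for
  \<open>v\<close>, placing it in the old span; so coefficient and remainder are unique.\<close>

lemma card_f3_span_insert:
  assumes "insert v B \<subseteq> f3_vecs n" "v \<notin> f3_span n B"
  shows "card (f3_span n (insert v B)) = 3 * card (f3_span n B)"
proof -
  have v: "v \<in> f3_vecs n" and B: "B \<subseteq> f3_vecs n" using assms by auto
  note spB = f3_span_subspace[OF B]
  have "inj_on (\<lambda>(c, w). f3_add (f3_smult c v) w) ({0..2} \<times> f3_span n B)"
  proof (rule inj_onI, clarify)
    fix c c' :: int and w w'
    assume c: "c \<in> {0..2}" "c' \<in> {0..2}" and w: "w \<in> f3_span n B" "w' \<in> f3_span n B"
      and eq: "f3_add (f3_smult c v) w = f3_add (f3_smult c' v) w'"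
    have ww: "w \<in> f3_vecs n" "w' \<in> f3_vecs n" using w spB by (auto simp: f3_subspace_def)
    have nth: "(c * v ! i + w ! i) mod 3 = (c' * v ! i + w' ! i) mod 3" if "i < n" for i
      using arg_cong[OF eq, of "\<lambda>u. u ! i"] that v ww by (simp add: f3_vecs_iff_nth mod_simps)
    have bd: "0 \<le> v ! i" "v ! i < 3" "0 \<le> w ! i" "w ! i < 3" "0 \<le> w' ! i" "w' ! i < 3" if "i < n" for i
      using that v ww by (auto simp: f3_vecs_iff_nth)
    have cc: "c = 0 \<or> c = 1 \<or> c = 2" "c' = 0 \<or> c' = 1 \<or> c' = 2" using c by auto
    show "c = c' \<and> w = w'"
    proof (cases "c = c'")
      case True
      have "w = w'"
      proof (rule nth_equalityI)
        show "length w = length w'" using ww by (simp add: f3_vecs_iff_nth)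
        fix i assume "i < length w"
        then have i: "i < n" using ww by (simp add: f3_vecs_iff_nth)
        have "[c * v ! i + w ! i = c * v ! i + w' ! i] (mod 3)"
          using nth[OF i] True by (simp add: cong_def)
        then have "[w ! i = w' ! i] (mod 3)" by (simp only: cong_add_lcancel)
        then show "w ! i = w' ! i" using bd[OF i] by (simp add: cong_def)
      qed
      with True show ?thesis by simp
    next
      case False
      \<comment> \<open>A nonzero residue modulo 3 is its own inverse, and 2 stands for -1: this
        solves (c - c') v = w' - w for \<open>v\<close>.\<close>
      define e where "e = (c - c') mod 3"
      have "v = f3_smult e (f3_add w' (f3_smult 2 w))"
      proof (rule nth_equalityI)
        show "length v = length (f3_smult e (f3_add w' (f3_smult 2 w)))"
          using v ww by (simp add: f3_vecs_iff_nth)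
        fix i assume "i < length v"
        then have i: "i < n" using v by (simp add: f3_vecs_iff_nth)
        have "[e * (w' ! i + 2 * w ! i) = (c - c') * (c * v ! i + w ! i - c' * v ! i + 2 * w ! i)] (mod 3)"
        proof (intro cong_mult cong_add cong_refl)
          show "[e = c - c'] (mod 3)" by (simp add: e_def cong_def)
          have "[c * v ! i + w ! i - c' * v ! i = c' * v ! i + w' ! i - c' * v ! i] (mod 3)"
            using nth[OF i] by (intro cong_diff) (simp_all add: cong_def)
          then show "[w' ! i = c * v ! i + w ! i - c' * v ! i] (mod 3)" by (simp add: cong_sym_eq)
        qed
        also have "(c - c') * (c * v ! i + w ! i - c' * v ! i + 2 * w ! i)
            = (c - c') * (c - c') * v ! i + 3 * ((c - c') * w ! i)"
          by (simp add: algebra_simps)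
        also have "[\<dots> = 1 * v ! i + 0] (mod 3)"
          using cc False by (intro cong_add cong_mult) (auto simp: cong_def)
        finally have "v ! i = (e * (w' ! i + 2 * w ! i)) mod 3"
          using bd[OF i] by (simp add: cong_def)
        then show "v ! i = f3_smult e (f3_add w' (f3_smult 2 w)) ! i"
          using i ww by (simp add: f3_vecs_iff_nth mod_simps)
      qed
      moreover have "e \<in> {0..2}" unfolding e_def using pos_mod_bound[of 3 "c - c'"]
        by (simp del: pos_mod_bound)
      ultimately have "v \<in> f3_span n B"
        using spB w f3_subspace_smult[OF spB] by (metis f3_subspace_def atLeastAtMost_iff
            zero_le_numeral order_refl)
      with assms(2) show ?thesis by simp
    qed
  qed
  then show ?thesis
    unfolding f3_span_insert[OF assms(1)] by (simp add: card_image card_cartesian_product)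
qed

text \<open>A largest independent subset spans \<open>V\<close>, since a vector outside its span
  could be added to it; a smaller spanning set is excluded because it generates too few
  vectors.\<close>

lemma card_f3_subspace:
  assumes V: "f3_subspace n V"
  shows "card V = 3 ^ f3_dim n V"
proof -
  have Vn: "V \<subseteq> f3_vecs n" using V by (simp add: f3_subspace_def)
  have finV: "finite V" by (rule finite_subset[OF Vn finite_f3_vecs])
  \<comment> \<open>Linear independence stated by counting: the \<open>m\<close> generators have all
    3^m combinations distinct.\<close>
  define P where "P = (\<lambda>m. \<exists>B. finite B \<and> card B = m \<and> B \<subseteq> V \<and> card (f3_span n B) = 3 ^ m)"
  have "f3_span n {} = {replicate n 0}"
    by (rule antisym[OF f3_span_subset])
      (auto simp: f3_subspace_def zero_in_f3_vecs f3_add_zero f3_span.zero)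
  then have "P 0" unfolding P_def by (intro exI[of _ "{}"]) simp
  moreover have "P m \<Longrightarrow> m \<le> card V" for m
    unfolding P_def using card_mono[OF finV] by blast
  ultimately obtain m where m: "P m" and max: "\<And>m'. P m' \<Longrightarrow> m' \<le> m"
    using Nat.ex_has_greatest_nat[of P 0 "card V"] by auto
  then obtain B where B: "finite B" "card B = m" "B \<subseteq> V" "card (f3_span n B) = 3 ^ m"
    unfolding P_def by blast
  have spBV: "f3_span n B = V"
  proof (rule ccontr)
    assume "f3_span n B \<noteq> V"
    then obtain v where v: "v \<in> V" "v \<notin> f3_span n B"
      using f3_span_subset[OF V B(3)] by blast
    have sub: "insert v B \<subseteq> f3_vecs n" using v B Vn by auto
    have "v \<notin> B" using v f3_span_superset[of B n] sub by auto
    then have "P (Suc m)"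
      unfolding P_def using B v card_f3_span_insert[OF sub v(2)]
      by (intro exI[of _ "insert v B"]) auto
    then show False using max by fastforce
  qed
  have "f3_dim n V = m"
    unfolding f3_dim_def
  proof (rule Least_equality)
    show "\<exists>B. finite B \<and> card B = m \<and> B \<subseteq> V \<and> f3_span n B = V"
      using B spBV by blast
    fix m' assume "\<exists>B. finite B \<and> card B = m' \<and> B \<subseteq> V \<and> f3_span n B = V"
    then obtain B' where "finite B'" "card B' = m'" "B' \<subseteq> V" "f3_span n B' = V" by blast
    then have "card V \<le> 3 ^ m'" using card_f3_span_le[of B' n] Vn by auto
    then show "m \<le> m'" using B spBV by simp
  qed
  then show ?thesis using B spBV by simp
qed

text \<open>Nondegeneracy of the dot product. Some vector of \<open>V\<close> starts with 1, as
  otherwise the first coordinate is an annihilating functional; with this pivot the claim reduces to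
  the slice of \<open>V\<close> with first entry 0, one dimension lower.\<close>

lemma f3_subspace_eq_vecs:
  assumes "f3_subspace n V"
    and "\<And>c. c \<in> f3_vecs n \<Longrightarrow> (\<And>v. v \<in> V \<Longrightarrow> 3 dvd (\<Sum>i<n. c ! i * v ! i)) \<Longrightarrow> c = replicate n 0"
  shows "V = f3_vecs n"
  using assms
proof (induction n arbitrary: V)
  case 0
  then show ?case by (auto simp: f3_subspace_def f3_vecs_def)
next
  case (Suc n)
  have Vn: "V \<subseteq> f3_vecs (Suc n)" and V0: "replicate (Suc n) 0 \<in> V"
    and Vadd: "\<And>v w. v \<in> V \<Longrightarrow> w \<in> V \<Longrightarrow> f3_add v w \<in> V"
    using Suc.prems(1) by (auto simp: f3_subspace_def)
  have Cons_vecs: "x # w \<in> f3_vecs (Suc n) \<longleftrightarrow> x \<in> {0..2} \<and> w \<in> f3_vecs n" for x w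
    by (auto simp: f3_vecs_def)
  have Cons_add: "f3_add (x # v) (y # w) = ((x + y) mod 3) # f3_add v w" for x y v w
    by (simp add: f3_add_def)
  have V_elim: "\<exists>x w. v = x # w \<and> x \<in> {0..2} \<and> w \<in> f3_vecs n" if "v \<in> V" for v
  proof (cases v)
    case Nil
    then show ?thesis using that Vn by (auto simp: f3_vecs_def)
  next
    case (Cons x w)
    then show ?thesis using that Vn Cons_vecs by auto
  qed
  have "\<exists>w. 1 # w \<in> V"
  proof (rule ccontr)
    assume no1: "\<nexists>w. 1 # w \<in> V"
    have head0: "x = 0" if xw: "x # w \<in> V" for x w
    proof -
      have "x \<in> {0..2}" using V_elim[OF xw] by auto
      moreover have "x \<noteq> 1" using no1 xw by auto
      moreover have "x \<noteq> 2" using Vadd[OF xw xw] no1 by (auto simp: Cons_add)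
      ultimately show ?thesis by auto
    qed
    have "1 # replicate n 0 = replicate (Suc n) (0::int)"
    proof (rule Suc.prems(2))
      show "1 # replicate n 0 \<in> f3_vecs (Suc n)" by (simp add: Cons_vecs zero_in_f3_vecs)
      fix v assume v: "v \<in> V"
      then obtain w where "v = 0 # w" using V_elim head0 by metis
      then show "3 dvd (\<Sum>i<Suc n. (1 # replicate n 0) ! i * v ! i)"
        by (simp add: sum.lessThan_Suc_shift del: sum.lessThan_Suc)
    qed
    then show False by simp
  qed
  then obtain w1 where w1: "1 # w1 \<in> V" by blast
  then have w1n: "w1 \<in> f3_vecs n" using V_elim by blast
  define V' where "V' = {w. 0 # w \<in> V}"
  have V'n: "V' \<subseteq> f3_vecs n" using V_elim unfolding V'_def by blast
  have V'sub: "f3_subspace n V'"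
    unfolding f3_subspace_def
  proof (intro conjI ballI)
    show "V' \<subseteq> f3_vecs n" by (fact V'n)
    show "replicate n 0 \<in> V'" using V0 by (simp add: V'_def)
    fix v w assume "v \<in> V'" "w \<in> V'"
    then show "f3_add v w \<in> V'" using Vadd[of "0 # v" "0 # w"] by (simp add: V'_def Cons_add)
  qed
  text \<open>Subtracting a multiple of \<open>1 # w1\<close> moves any vector of \<open>V\<close> into \<open>0 # V'\<close>.\<close>
  have red: "f3_add w (f3_smult (- x) w1) \<in> V'" if xw: "x # w \<in> V" for x w
  proof -
    have x: "x \<in> {0..2}" and w: "w \<in> f3_vecs n" using V_elim[OF xw] by auto
    define e where "e = (- x) mod 3"
    have e: "e \<in> {0..2}" unfolding e_def using pos_mod_bound[of 3 "- x"] by (simp del: pos_mod_bound)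
    have "f3_add (x # w) (f3_smult e (1 # w1)) \<in> V"
      using Vadd xw f3_subspace_smult[OF Suc.prems(1) w1 e] by blast
    moreover have "f3_add (x # w) (f3_smult e (1 # w1)) = 0 # f3_add w (f3_smult (- x) w1)"
      unfolding e_def using w w1n
      by (auto simp: f3_add_def f3_smult_def mod_simps mult.commute intro!: nth_equalityI)
    ultimately show ?thesis by (simp add: V'_def)
  qed
  have "V' = f3_vecs n"
  proof (rule Suc.IH[OF V'sub])
    fix c assume c: "c \<in> f3_vecs n" and ann: "\<And>v. v \<in> V' \<Longrightarrow> 3 dvd (\<Sum>i<n. c ! i * v ! i)"
    \<comment> \<open>The entry \<open>h\<close> is chosen so that \<open>h # c\<close> annihilates
      the pivot \<open>1 # w1\<close>; together with the slice this covers all of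
      \<open>V\<close>.\<close>
    define h where "h = (- (\<Sum>i<n. c ! i * w1 ! i)) mod 3"
    have h: "h \<in> {0..2}" unfolding h_def using pos_mod_bound[of 3] by (simp del: pos_mod_bound)
    have "h # c = replicate (Suc n) 0"
    proof (rule Suc.prems(2))
      show "h # c \<in> f3_vecs (Suc n)" using c h by (simp add: Cons_vecs)
      fix v assume v: "v \<in> V"
      then obtain x w where xw: "v = x # w" "w \<in> f3_vecs n" using V_elim by blast
      have len: "length w = n" "length w1 = n" using xw w1n by (auto simp: f3_vecs_def)
      have "[0 = (\<Sum>i<n. c ! i * f3_add w (f3_smult (- x) w1) ! i)] (mod 3)"
        using ann[OF red, of x w] v xw by (simp add: cong_iff_dvd_diff)
      also have "[(\<Sum>i<n. c ! i * f3_add w (f3_smult (- x) w1) ! i)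
          = (\<Sum>i<n. c ! i * (w ! i - x * w1 ! i))] (mod 3)"
        using len by (intro cong_sum cong_mult) (auto simp: cong_def mod_simps)
      also have "(\<Sum>i<n. c ! i * (w ! i - x * w1 ! i))
          = - (\<Sum>i<n. c ! i * w1 ! i) * x + (\<Sum>i<n. c ! i * w ! i)"
        by (simp add: sum_distrib_left sum_distrib_right sum_subtractf right_diff_distrib mult_ac)
      also have "[\<dots> = h * x + (\<Sum>i<n. c ! i * w ! i)] (mod 3)"
        unfolding h_def by (intro cong_add cong_mult) (auto simp: cong_def)
      finally have "3 dvd h * x + (\<Sum>i<n. c ! i * w ! i)"
        by (metis cong_0_iff cong_sym)
      then show "3 dvd (\<Sum>i<Suc n. (h # c) ! i * v ! i)"
        by (simp add: xw sum.lessThan_Suc_shift del: sum.lessThan_Suc)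
    qed
    then show "c = replicate n 0" by simp
  qed
  show ?case
  proof (rule antisym[OF Vn], rule subsetI)
    fix v assume v: "v \<in> f3_vecs (Suc n)"
    then obtain x w where xw: "v = x # w" "x \<in> {0..2}" "w \<in> f3_vecs n"
      by (cases v) (auto simp: Cons_vecs, auto simp: f3_vecs_def)
    have "0 # f3_add w (f3_smult (- x) w1) \<in> V"
      using \<open>V' = f3_vecs n\<close> xw w1n by (auto simp: V'_def intro!: f3_add_in_vecs f3_smult_in_vecs)
    then have "f3_add (f3_smult x (1 # w1)) (0 # f3_add w (f3_smult (- x) w1)) \<in> V"
      using Vadd f3_subspace_smult[OF Suc.prems(1) w1 xw(2)] by blast
    also have "f3_add (f3_smult x (1 # w1)) (0 # f3_add w (f3_smult (- x) w1)) = v"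
      using xw w1n by (intro nth_equalityI)
        (auto simp: f3_vecs_iff_nth nth_Cons mod_simps split: nat.splits)
    finally show "v \<in> V" .
  qed
qed

subsection \<open>The Gray map in terms of ternary digits\<close>

text \<open>The Gray map as a function of a low digit \<open>p\<close> and a high digit
  \<open>q\<close> that vary independently; in this form it is linear over F_3.\<close>

definition gray_pair :: "int \<Rightarrow> int \<Rightarrow> int list" where
  "gray_pair p q = [q mod 3, (q + p) mod 3, (q + 2 * p) mod 3]"

definition gray_triple :: "int list \<times> int list \<times> int list \<Rightarrow> int list" where
  "gray_triple = (\<lambda>(x, y, z). x @ concat (map2 gray_pair y z))"

definition triples :: "nat \<Rightarrow> nat \<Rightarrow> (int list \<times> int list \<times> int list) set" where
  "triples a b = f3_vecs a \<times> f3_vecs b \<times> f3_vecs b"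

definition triple_add ::
  "int list \<times> int list \<times> int list \<Rightarrow> int list \<times> int list \<times> int list \<Rightarrow> int list \<times> int list \<times> int list" where
  "triple_add = (\<lambda>(x, y, z) (x', y', z'). (f3_add x x', f3_add y y', f3_add z z'))"

definition triple_subspace :: "nat \<Rightarrow> nat \<Rightarrow> (int list \<times> int list \<times> int list) set \<Rightarrow> bool" where
  "triple_subspace a b T \<longleftrightarrow> T \<subseteq> triples a b \<and>
     (replicate a 0, replicate b 0, replicate b 0) \<in> T \<and> (\<forall>s\<in>T. \<forall>t\<in>T. triple_add s t \<in> T)"

definition digits :: "int list \<times> int list \<Rightarrow> int list \<times> int list \<times> int list" where
  "digits = (\<lambda>(x, y). (x, map (\<lambda>t. t mod 3) y, map (\<lambda>t. t div 3) y))"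

lemma Gray_eq_digits: "Gray u = gray_triple (digits u)"
proof -
  have "concat (map gray y) = concat (map2 gray_pair (map (\<lambda>t. t mod 3) y) (map (\<lambda>t. t div 3) y))" for y
    by (induction y) (simp_all add: gray_def gray_pair_def Let_def)
  then show ?thesis by (cases u) (simp add: Gray_def gray_triple_def digits_def)
qed

lemma gray_triple_in_vecs:
  assumes "t \<in> triples a b"
  shows "gray_triple t \<in> f3_vecs (a + 3 * b)"
proof -
  have *: "length y = b \<Longrightarrow> length z = b \<Longrightarrow> concat (map2 gray_pair y z) \<in> f3_vecs (3 * b)" for y z
  proof (induction y z arbitrary: b rule: list_induct2')
    case (4 y ys z zs)
    have "(t::int) mod 3 \<in> {0..2}" for t using pos_mod_bound[of 3 t] by (simp del: pos_mod_bound)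
    then show ?case using 4 by (cases b) (auto simp: f3_vecs_def gray_pair_def)
  qed (auto simp: f3_vecs_def)
  obtain x y z where t: "t = (x, y, z)" "x \<in> f3_vecs a" "length y = b" "length z = b"
    using assms by (auto simp: triples_def f3_vecs_def)
  then show ?thesis using *[of y z] by (auto simp: gray_triple_def f3_vecs_def)
qed

lemma gray_triple_add:
  assumes "s \<in> triples a b" "t \<in> triples a b"
  shows "gray_triple (triple_add s t) = f3_add (gray_triple s) (gray_triple t)"
proof -
  have *: "length z = length y \<Longrightarrow> length y' = length y \<Longrightarrow> length z' = length y \<Longrightarrow>
    concat (map2 gray_pair (f3_add y y') (f3_add z z'))
      = f3_add (concat (map2 gray_pair y z)) (concat (map2 gray_pair y' z'))" for y z y' z'
  proof (induction y arbitrary: z y' z')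
    case Nil
    then show ?case by (simp add: f3_add_def)
  next
    case (Cons p y)
    then obtain q zz p' yy' q' zz' where "z = q # zz" "y' = p' # yy'" "z' = q' # zz'"
      by (auto simp: length_Suc_conv)
    moreover have "gray_pair ((p + p') mod 3) ((q + q') mod 3)
        = [(q mod 3 + q' mod 3) mod 3, ((q + p) mod 3 + (q' + p') mod 3) mod 3,
           ((q + 2 * p) mod 3 + (q' + 2 * p') mod 3) mod 3]"
    proof -
      have "[(q + q') mod 3 + 2 * ((p + p') mod 3) = q + q' + 2 * (p + p')] (mod 3)"
        by (intro cong_add cong_mult cong_mod_leftI cong_refl)
      moreover have "q + q' + 2 * (p + p') = q + 2 * p + (q' + 2 * p')" by simp
      moreover have "q + q' + (p + p') = q + p + (q' + p')" by simp
      ultimately show ?thesis by (simp only: gray_pair_def cong_def mod_add_eq mod_mod_trivial)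
    qed
    ultimately show ?case using Cons.prems Cons.IH[of zz yy' zz']
      by (simp add: f3_add_def) (simp add: gray_pair_def)
  qed
  have app: "length v = length v' \<Longrightarrow> f3_add (v @ w) (v' @ w') = f3_add v v' @ f3_add w w'" for v v' w w'
    by (simp add: f3_add_def)
  show ?thesis using assms *
    by (auto simp: triples_def gray_triple_def triple_add_def f3_vecs_def app)
qed

lemma gray_triple_zero: "gray_triple (replicate a 0, replicate b 0, replicate b 0) = replicate (a + 3 * b) 0"
proof -
  have "concat (map2 gray_pair (replicate b 0) (replicate b 0)) = replicate (3 * b) 0"
    by (induction b) (simp_all add: gray_pair_def numeral_3_eq_3)
  then show ?thesis by (simp add: gray_triple_def replicate_add)
qed

text \<open>The first entry of each block returns the high digit, the second then returns the low
  one.\<close>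

lemma inj_on_gray_triple: "inj_on gray_triple (triples a b)"
proof -
  have *: "length z = length y \<Longrightarrow> length y' = length y \<Longrightarrow> length z' = length y \<Longrightarrow>
    set y \<subseteq> {0..2} \<Longrightarrow> set z \<subseteq> {0..2} \<Longrightarrow> set y' \<subseteq> {0..2} \<Longrightarrow> set z' \<subseteq> {0..2} \<Longrightarrow>
    concat (map2 gray_pair y z) = concat (map2 gray_pair y' z') \<Longrightarrow> y = y' \<and> z = z'" for y z y' z'
  proof (induction y arbitrary: z y' z')
    case Nil
    then show ?case by simp
  next
    case (Cons p y)
    then obtain q zz p' yy' q' zz' where eq: "z = q # zz" "y' = p' # yy'" "z' = q' # zz'"
      by (auto simp: length_Suc_conv)
    have qq: "q = q'" using Cons.prems by (auto simp: eq gray_pair_def)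
    have "[q + p = q + p'] (mod 3)"
      using Cons.prems qq by (auto simp: eq gray_pair_def cong_def)
    then have "[p = p'] (mod 3)" by (simp only: cong_add_lcancel)
    then have pp: "p = p'" using Cons.prems by (auto simp: eq cong_def)
    have "y = yy' \<and> zz = zz'"
      by (rule Cons.IH) (use Cons.prems in \<open>simp_all add: eq gray_pair_def\<close>)
    then show ?case by (simp add: eq pp qq)
  qed
  show ?thesis
  proof (rule inj_onI)
    fix s t assume "s \<in> triples a b" "t \<in> triples a b" "gray_triple s = gray_triple t"
    moreover obtain x y z x' y' z' where "s = (x, y, z)" "t = (x', y', z')"
      by (cases s, cases t)
    ultimately show "s = t"
      using *[of z y y' z'] by (simp add: triples_def gray_triple_def f3_vecs_def)
  qed
qed

section \<open>From the rank to subspaces of digit triples\<close>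

lemma Z3Z9_space_iff_nth:
  "(x, y) \<in> Z3Z9_space a b \<longleftrightarrow> length x = a \<and> length y = b \<and>
     (\<forall>i<a. 0 \<le> x ! i \<and> x ! i < 3) \<and> (\<forall>i<b. 0 \<le> y ! i \<and> y ! i < 9)"
  by (force simp: Z3Z9_space_def set_conv_nth subset_iff)

lemma digits_in_triples: "u \<in> Z3Z9_space a b \<Longrightarrow> digits u \<in> triples a b"
  by (cases u) (auto simp: triples_def digits_def Z3Z9_space_iff_nth f3_vecs_iff_nth)

lemma Gray_image_subset: "C \<subseteq> Z3Z9_space a b \<Longrightarrow> Gray ` C \<subseteq> f3_vecs (a + 3 * b)"
  using gray_triple_in_vecs[OF digits_in_triples] by (auto simp: Gray_eq_digits)

lemma card_span_Gray:
  assumes "C \<subseteq> Z3Z9_space a b"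
  shows "3 ^ code_rank a b C = card (f3_span (a + 3 * b) (Gray ` C))"
  unfolding code_rank_def
  using card_f3_subspace[OF f3_span_subspace[OF Gray_image_subset[OF assms]]] by simp

lemma finite_triples [simp]: "finite (triples a b)"
  by (simp add: triples_def)

text \<open>The image of \<open>T\<close> under the linear map \<open>gray_triple\<close> is a
  subspace containing the Gray image, hence its span.\<close>

lemma code_rank_upper:
  assumes C: "C \<subseteq> Z3Z9_space a b" and T: "triple_subspace a b T" and sub: "digits ` C \<subseteq> T"
  shows "3 ^ code_rank a b C \<le> card T"
proof -
  let ?V = "gray_triple ` T"
  have Tn: "T \<subseteq> triples a b" using T by (simp add: triple_subspace_def)
  have "f3_subspace (a + 3 * b) ?V"
    unfolding f3_subspace_def
  proof (intro conjI ballI)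
    show "?V \<subseteq> f3_vecs (a + 3 * b)" using Tn gray_triple_in_vecs by auto
    show "replicate (a + 3 * b) 0 \<in> ?V" using T
      by (intro image_eqI[where f = gray_triple, OF gray_triple_zero[symmetric]]) (simp add: triple_subspace_def)
    fix v w assume "v \<in> ?V" "w \<in> ?V"
    then obtain s t where st: "s \<in> T" "t \<in> T" "v = gray_triple s" "w = gray_triple t" by auto
    then have "f3_add v w = gray_triple (triple_add s t)"
      using gray_triple_add[OF subsetD[OF Tn] subsetD[OF Tn]] by simp
    then show "f3_add v w \<in> ?V" using T st by (auto simp: triple_subspace_def)
  qed
  moreover have "Gray ` C \<subseteq> ?V" using sub by (auto simp: Gray_eq_digits)
  ultimately have "f3_span (a + 3 * b) (Gray ` C) \<subseteq> ?V" by (rule f3_span_subset)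
  moreover have "finite T" using Tn finite_subset[OF _ finite_triples] by blast
  ultimately show ?thesis
    unfolding card_span_Gray[OF C]
    by (meson card_image_le card_mono finite_imageI le_trans)
qed

text \<open>The preimage of the span under \<open>gray_triple\<close> serves as \<open>T\<close>;
  injectivity keeps it no larger than the span.\<close>

lemma code_rank_lower:
  assumes C: "C \<subseteq> Z3Z9_space a b"
  obtains T where "triple_subspace a b T" "digits ` C \<subseteq> T" "card T \<le> 3 ^ code_rank a b C"
proof
  let ?V = "f3_span (a + 3 * b) (Gray ` C)"
  let ?T = "{t \<in> triples a b. gray_triple t \<in> ?V}"
  have V: "f3_subspace (a + 3 * b) ?V" by (rule f3_span_subspace[OF Gray_image_subset[OF C]])
  show "triple_subspace a b ?T"
    unfolding triple_subspace_def
  proof (intro conjI ballI)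
    show "?T \<subseteq> triples a b" by auto
    show "(replicate a 0, replicate b 0, replicate b 0) \<in> ?T"
      by (simp add: gray_triple_zero triples_def zero_in_f3_vecs f3_span.zero)
    fix s t assume st: "s \<in> ?T" "t \<in> ?T"
    have "triple_add s t \<in> triples a b"
      using st by (auto simp: triples_def triple_add_def f3_add_in_vecs)
    then show "triple_add s t \<in> ?T"
      using st gray_triple_add[of s a b t] V by (auto simp: f3_subspace_def)
  qed
  show "digits ` C \<subseteq> ?T"
    using C digits_in_triples f3_span_superset[OF Gray_image_subset[OF C]]
    by (auto simp: Gray_eq_digits[symmetric])
  have "finite ?V" using V finite_subset[OF _ finite_f3_vecs] by (auto simp: f3_subspace_def)
  moreover have "inj_on gray_triple ?T"
    by (rule inj_on_subset[OF inj_on_gray_triple]) auto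
  ultimately show "card ?T \<le> 3 ^ code_rank a b C"
    unfolding card_span_Gray[OF C] by (intro card_inj_on_le[of gray_triple]) auto
qed

lemma inj_on_digits: "inj_on digits (Z3Z9_space a b)"
proof (rule inj_onI, clarify)
  fix x y x' y'
  assume *: "(x, y) \<in> Z3Z9_space a b" "(x', y') \<in> Z3Z9_space a b" "digits (x, y) = digits (x', y')"
  have "y = y'"
  proof (rule nth_equalityI)
    show "length y = length y'" using * by (simp add: Z3Z9_space_iff_nth)
    fix i assume i: "i < length y"
    then have i': "i < length y'" using * by (simp add: Z3Z9_space_iff_nth)
    have "map (\<lambda>t. t mod 3) y ! i = map (\<lambda>t. t mod 3) y' ! i"
      "map (\<lambda>t. t div 3) y ! i = map (\<lambda>t. t div 3) y' ! i"
      using * by (simp_all add: digits_def)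
    then show "y ! i = y' ! i"
      using i i' by (simp, metis mult_div_mod_eq)
  qed
  then show "x = x' \<and> y = y'" using * by (simp add: digits_def)
qed

text \<open>The source of the lower end of the range: the span has at least as many elements as the
  code, and the type fixes the size of the code.\<close>

lemma card_code_le_rank:
  assumes C: "C \<subseteq> Z3Z9_space a b"
  shows "card C \<le> 3 ^ code_rank a b C"
proof -
  obtain T where T: "triple_subspace a b T" "digits ` C \<subseteq> T" "card T \<le> 3 ^ code_rank a b C"
    using code_rank_lower[OF C] .
  have "finite T" using T(1) finite_subset[OF _ finite_triples] by (auto simp: triple_subspace_def)
  then have "card C \<le> card T"
    using T(2) inj_on_subset[OF inj_on_digits C] by (intro card_inj_on_le) auto
  then show ?thesis using T(3) by simp
qed

subsection \<open>Types and the bound by the length\<close>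

definition z9_add :: "int list \<Rightarrow> int list \<Rightarrow> int list" where
  "z9_add y y' = map2 (\<lambda>a b. (a + b) mod 9) y y'"

lemma length_z9_add [simp]: "length (z9_add v w) = min (length v) (length w)"
  by (simp add: z9_add_def)

lemma nth_z9_add [simp]:
  "i < length v \<Longrightarrow> i < length w \<Longrightarrow> z9_add v w ! i = (v ! i + w ! i) mod 9"
  by (simp add: z9_add_def)

lemma z39_add_Pair: "z39_add (x, y) (x', y') = (f3_add x x', z9_add y y')"
  by (simp add: z39_add_def f3_add_def z9_add_def)

lemma fst_z39_add: "fst (z39_add u v) = f3_add (fst u) (fst v)"
  and snd_z39_add: "snd (z39_add u v) = z9_add (snd u) (snd v)"
  by (simp_all add: z39_add_def f3_add_def z9_add_def)

lemma z39_add_assoc: "z39_add (z39_add u v) w = z39_add u (z39_add v w)"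
proof -
  have "z9_add (z9_add x y) z = z9_add x (z9_add y z)" for x y z
    by (rule nth_equalityI) (auto simp: mod_simps add.assoc)
  then show ?thesis
    by (cases u, cases v, cases w) (simp add: z39_add_Pair f3_add_assoc)
qed

lemma z39_add_commute: "z39_add u v = z39_add v u"
proof -
  have "z9_add x y = z9_add y x" "f3_add x y = f3_add y x" for x y
    by (rule nth_equalityI; auto simp: add.commute)+
  then show ?thesis by (cases u, cases v) (simp add: z39_add_Pair)
qed

lemma z39_add_zero: "u \<in> Z3Z9_space a b \<Longrightarrow> z39_add (z39_zero a b) u = u"
  by (cases u) (auto simp: z39_zero_def z39_add_Pair Z3Z9_space_iff_nth intro!: nth_equalityI)

lemma z39_add_neg: "u \<in> Z3Z9_space a b \<Longrightarrow> z39_add (z39_neg u) u = z39_zero a b"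
  by (cases u) (auto simp: z39_zero_def z39_neg_def z39_add_Pair Z3Z9_space_iff_nth mod_simps
      intro!: nth_equalityI)

lemma z39_zero_in_space: "z39_zero a b \<in> Z3Z9_space a b"
  by (simp add: z39_zero_def Z3Z9_space_iff_nth)

lemma z39_add_in_space:
  "u \<in> Z3Z9_space a b \<Longrightarrow> v \<in> Z3Z9_space a b \<Longrightarrow> z39_add u v \<in> Z3Z9_space a b"
  by (cases u, cases v) (simp add: z39_add_Pair Z3Z9_space_iff_nth)

lemma z39_neg_in_space: "u \<in> Z3Z9_space a b \<Longrightarrow> z39_neg u \<in> Z3Z9_space a b"
  by (cases u) (simp add: z39_neg_def Z3Z9_space_iff_nth)

lemma z39_add_eq_self:
  assumes "u \<in> Z3Z9_space a b" "v \<in> Z3Z9_space a b" "z39_add u v = v"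
  shows "u = z39_zero a b"
proof -
  have "u = z39_add u (z39_add v (z39_neg v))"
    using z39_add_neg[OF assms(2)] z39_add_zero[OF assms(1)] by (simp add: z39_add_commute)
  also have "\<dots> = z39_add v (z39_neg v)"
    using assms(3) by (simp add: z39_add_assoc[symmetric])
  finally show ?thesis using z39_add_neg[OF assms(2)] by (simp add: z39_add_commute)
qed

lemma Z3Z9_space_eq: "Z3Z9_space a b = f3_vecs a \<times> {y. set y \<subseteq> {0..8} \<and> length y = b}"
  by (auto simp: Z3Z9_space_def f3_vecs_def)

lemma finite_Z3Z9_space [simp]: "finite (Z3Z9_space a b)"
  by (simp add: Z3Z9_space_eq finite_lists_length_eq)

lemma card_Z3Z9_space: "card (Z3Z9_space a b) = 3 ^ a * 9 ^ b"
  by (simp add: Z3Z9_space_eq card_cartesian_product card_f3_vecs card_lists_length_eq)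

lemma additive_code_space: "additive_code a b (Z3Z9_space a b)"
  by (simp add: additive_code_def z39_zero_in_space z39_add_in_space z39_neg_in_space)

text \<open>Counting by fibres as in the first isomorphism theorem. The target of \<open>h\<close>
  carries no group structure; it is enough that translations respect equality of \<open>h\<close>,
  since then every fibre is a translate of the kernel.\<close>

lemma card_code_hom_image:
  assumes C: "additive_code a b C"
    and cong: "\<And>u v w. u \<in> C \<Longrightarrow> v \<in> C \<Longrightarrow> w \<in> C \<Longrightarrow> h u = h v \<Longrightarrow>
      h (z39_add w u) = h (z39_add w v)"
  shows "card C = card (h ` C) * card {u \<in> C. h u = h (z39_zero a b)}"
proof -
  let ?K = "{u \<in> C. h u = h (z39_zero a b)}"
  have sp: "C \<subseteq> Z3Z9_space a b" and z: "z39_zero a b \<in> C"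
    and add: "\<And>u v. u \<in> C \<Longrightarrow> v \<in> C \<Longrightarrow> z39_add u v \<in> C" and neg: "\<And>u. u \<in> C \<Longrightarrow> z39_neg u \<in> C"
    using C by (auto simp: additive_code_def)
  have fin: "finite C" using finite_subset[OF sp] by simp
  have "card {v \<in> C. h v = h u} = card ?K" if u: "u \<in> C" for u
  proof -
    have us: "u \<in> Z3Z9_space a b" using u sp by auto
    have c1: "z39_add (z39_neg u) (z39_add u v) = v" if "v \<in> C" for v
      using z39_add_zero[OF subsetD[OF sp that]]
      by (simp add: z39_add_assoc[symmetric] z39_add_neg[OF us])
    have c2: "z39_add u (z39_add (z39_neg u) v) = v" if "v \<in> C" for v
      using z39_add_zero[OF subsetD[OF sp that]] z39_add_neg[OF us]
      by (simp add: z39_add_assoc[symmetric] z39_add_commute[of u])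
    have "bij_betw (z39_add u) ?K {v \<in> C. h v = h u}"
    proof (rule bij_betw_byWitness[where f' = "z39_add (z39_neg u)"])
      show "\<forall>v\<in>?K. z39_add (z39_neg u) (z39_add u v) = v" using c1 by simp
      show "\<forall>v\<in>{v \<in> C. h v = h u}. z39_add u (z39_add (z39_neg u) v) = v" using c2 by simp
      show "z39_add u ` ?K \<subseteq> {v \<in> C. h v = h u}"
        using cong[OF _ z u] add[OF u] z39_add_zero[OF us] z39_add_commute[of u "z39_zero a b"]
        by auto
      show "z39_add (z39_neg u) ` {v \<in> C. h v = h u} \<subseteq> ?K"
        using cong[OF _ u neg[OF u]] add[OF neg[OF u]] z39_add_neg[OF us] by auto
    qed
    then show ?thesis by (simp add: bij_betw_same_card)
  qed
  then have "(\<Sum>t\<in>h ` C. card {v \<in> C. h v = t}) = (\<Sum>t\<in>h ` C. card ?K)"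
    by (intro sum.cong) auto
  moreover have "card C = (\<Sum>t\<in>h ` C. card {v \<in> C. h v = t})"
    using sum.image_gen[OF fin, of "\<lambda>_. 1::nat" h] by simp
  ultimately show ?thesis by simp
qed

section \<open>The torsion subcode and the cardinalities determined by the type\<close>

definition torsion :: "nat \<Rightarrow> nat \<Rightarrow> (int list \<times> int list) set \<Rightarrow> (int list \<times> int list) set" where
  "torsion a b C = {u \<in> C. z39_add u (z39_add u u) = z39_zero a b}"

lemma triple_z39_eq_zero_iff:
  assumes "u \<in> Z3Z9_space a b"
  shows "z39_add u (z39_add u u) = z39_zero a b \<longleftrightarrow> (\<forall>i<b. 3 dvd snd u ! i)"
proof -
  obtain x y where u: "u = (x, y)" by (cases u)
  then have len: "length x = a" "length y = b" using assms by (auto simp: Z3Z9_space_iff_nth)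
  have "f3_add x (f3_add x x) = replicate a 0"
  proof (rule nth_equalityI)
    fix i assume "i < length (f3_add x (f3_add x x))"
    then show "f3_add x (f3_add x x) ! i = replicate a 0 ! i"
      using len by (simp add: mod_simps)
  qed (use len in simp)
  moreover have "z9_add y (z9_add y y) = replicate b 0 \<longleftrightarrow> (\<forall>i<b. (3 * y ! i) mod 9 = 0)"
    using len by (auto simp: list_eq_iff_nth_eq mod_simps)
  moreover have "(3 * t) mod 9 = 0 \<longleftrightarrow> 3 dvd t" for t :: int by presburger
  ultimately show ?thesis by (simp add: u z39_add_Pair z39_zero_def)
qed

lemma z39_hom_zero:
  assumes "additive_code a b C" "f ` Z3Z9_space g d \<subseteq> C"
    and "\<forall>u\<in>Z3Z9_space g d. \<forall>v\<in>Z3Z9_space g d. f (z39_add u v) = z39_add (f u) (f v)"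
  shows "f (z39_zero g d) = z39_zero a b"
proof -
  let ?z = "z39_zero g d"
  have "f ?z \<in> Z3Z9_space a b"
    using assms z39_zero_in_space[of g d] by (auto simp: additive_code_def)
  moreover have "z39_add (f ?z) (f ?z) = f ?z"
    using assms(3) z39_zero_in_space[of g d] z39_add_zero[OF z39_zero_in_space[of g d]] by metis
  ultimately show ?thesis by (metis z39_add_eq_self)
qed

lemma card_torsion_space: "card (torsion g d (Z3Z9_space g d)) = 3 ^ (g + d)"
proof -
  have "torsion g d (Z3Z9_space g d) = f3_vecs g \<times> {y. set y \<subseteq> {0, 3, 6} \<and> length y = d}"
  proof -
    have *: "(\<forall>i<length y. 0 \<le> y ! i \<and> y ! i < 9) \<and> (\<forall>i<length y. 3 dvd y ! i) \<longleftrightarrow>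
        set y \<subseteq> {0, 3, 6}" for y :: "int list"
    proof -
      have "0 \<le> t \<and> t < 9 \<and> 3 dvd t \<longleftrightarrow> t \<in> {0, 3, 6}" for t :: int
        by (simp, presburger)
      then show ?thesis unfolding subset_iff in_set_conv_nth by metis
    qed
    have "(x, y) \<in> torsion g d (Z3Z9_space g d) \<longleftrightarrow>
        x \<in> f3_vecs g \<and> length y = d \<and> set y \<subseteq> {0, 3, 6}" for x y
      unfolding torsion_def
      using triple_z39_eq_zero_iff[of "(x, y)" g d] *[of y]
      by (auto simp: Z3Z9_space_iff_nth f3_vecs_iff_nth)
    then show ?thesis by auto
  qed
  moreover have "card {0, 3, 6 :: int} = 3" by simp
  moreover have "card {y. set y \<subseteq> {0, 3, 6 :: int} \<and> length y = d} = card {0, 3, 6 :: int} ^ d"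
    by (rule card_lists_length_eq) simp
  ultimately show ?thesis
    by (simp only: card_cartesian_product card_f3_vecs power_add)
qed

lemma additive_code_torsion:
  assumes "additive_code a b C"
  shows "additive_code a b (torsion a b C)"
proof -
  have sp: "C \<subseteq> Z3Z9_space a b" using assms by (simp add: additive_code_def)
  have t: "u \<in> torsion a b C \<longleftrightarrow> u \<in> C \<and> (\<forall>i<b. 3 dvd snd u ! i)" for u
    unfolding torsion_def using triple_z39_eq_zero_iff[of u a b] sp by auto
  have len: "length (snd u) = b" if "u \<in> C" for u
    using that sp by (cases u) (auto simp: Z3Z9_space_def)
  have m: "3 dvd s \<Longrightarrow> 3 dvd s mod 9" for s :: int by presburger
  show ?thesis
    using assms unfolding additive_code_def
    by (auto simp: t len z39_zero_def snd_z39_add z39_neg_def m)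
qed

lemma fst_torsion_eq: "fst ` torsion a b C
    = {x. \<exists>y. (x, y) \<in> C \<and> z39_add (x, y) (z39_add (x, y) (x, y)) = z39_zero a b}"
  by (force simp: torsion_def)

lemma f3_subspace_fst_torsion:
  assumes C: "additive_code a b C"
  shows "f3_subspace a (fst ` torsion a b C)"
proof -
  have T: "additive_code a b (torsion a b C)" by (rule additive_code_torsion[OF C])
  show ?thesis
    unfolding f3_subspace_def
  proof (intro conjI ballI)
    show "fst ` torsion a b C \<subseteq> f3_vecs a"
      using T by (auto simp: additive_code_def Z3Z9_space_eq)
    show "replicate a 0 \<in> fst ` torsion a b C"
      using T by (force simp: additive_code_def z39_zero_def)
    fix x x' assume "x \<in> fst ` torsion a b C" "x' \<in> fst ` torsion a b C"
    then obtain u u' where "u \<in> torsion a b C" "u' \<in> torsion a b C" "x = fst u" "x' = fst u'"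
      by auto
    then show "f3_add x x' \<in> fst ` torsion a b C"
      using T fst_z39_add[of u u'] by (metis additive_code_def imageI)
  qed
qed

text \<open>The isomorphism transports size and 3-torsion from the model group, and the torsion
  projection is a subspace of dimension \<open>k\<close>. From here on the upper bound by the length
  uses the type only through these counts.\<close>

lemma code_type_card:
  assumes "code_type a b g d k C"
  shows "card C = 3 ^ (g + 2 * d)"
    and "card (torsion a b C) = 3 ^ (g + d)"
    and "card (fst ` torsion a b C) = 3 ^ k"
proof -
  obtain f where C: "additive_code a b C" and f: "bij_betw f (Z3Z9_space g d) C"
    and hom: "\<forall>u\<in>Z3Z9_space g d. \<forall>v\<in>Z3Z9_space g d. f (z39_add u v) = z39_add (f u) (f v)"
    and dim: "f3_dim a {x. \<exists>y. (x, y) \<in> C \<and> z39_add (x, y) (z39_add (x, y) (x, y)) = z39_zero a b} = k"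
    using assms unfolding code_type_def by blast
  have "(9::nat) ^ d = 3 ^ (2 * d)" by (simp add: power_mult)
  then show "card C = 3 ^ (g + 2 * d)"
    using bij_betw_same_card[OF f] by (simp add: card_Z3Z9_space power_add)
  have fsub: "f ` Z3Z9_space g d \<subseteq> C" and inj: "inj_on f (Z3Z9_space g d)"
    using f by (auto simp: bij_betw_def)
  have "z39_add (f u) (z39_add (f u) (f u)) = z39_zero a b \<longleftrightarrow> z39_add u (z39_add u u) = z39_zero g d"
    if u: "u \<in> Z3Z9_space g d" for u
  proof -
    have "z39_add (f u) (z39_add (f u) (f u)) = f (z39_add u (z39_add u u))"
      using hom u by (simp add: z39_add_in_space)
    then show ?thesis
      using inj_on_eq_iff[OF inj] z39_hom_zero[OF C fsub hom] u
      by (metis z39_add_in_space z39_zero_in_space)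
  qed
  then have "torsion a b C = f ` torsion g d (Z3Z9_space g d)"
    using f unfolding torsion_def bij_betw_def by auto
  moreover have "inj_on f (torsion g d (Z3Z9_space g d))"
    using inj by (rule inj_on_subset) (auto simp: torsion_def)
  ultimately show "card (torsion a b C) = 3 ^ (g + d)"
    by (simp add: card_image card_torsion_space)
  show "card (fst ` torsion a b C) = 3 ^ k"
    using card_f3_subspace[OF f3_subspace_fst_torsion[OF C]] dim by (simp only: fst_torsion_eq)
qed

section \<open>Low digits and the upper bound by the length\<close>

definition low_digits :: "int list \<times> int list \<Rightarrow> int list \<times> int list" where
  "low_digits = (\<lambda>(x, y). (x, map (\<lambda>t. t mod 3) y))"

lemma map_mod3_z9_add:
  "length y = length y' \<Longrightarrow> map (\<lambda>t. t mod 3) (z9_add y y')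
     = f3_add (map (\<lambda>t. t mod 3) y) (map (\<lambda>t. t mod 3) y')"
  by (rule nth_equalityI) (auto simp: mod_mod_cancel mod_simps)

text \<open>A codeword is killed by \<open>low_digits\<close> exactly if it is torsion with
  vanishing ternary part. So this kernel is also the kernel of \<open>fst\<close> on the torsion
  subcode, of size 3^(g + d - k), and dividing the size of \<open>C\<close> by it leaves 3^(d +
  k).\<close>

lemma card_low_digits:
  assumes type: "code_type a b g d k C"
  shows "card (low_digits ` C) = 3 ^ (d + k)"
proof -
  have C: "additive_code a b C" using type by (simp add: code_type_def)
  have sp: "C \<subseteq> Z3Z9_space a b" using C by (simp add: additive_code_def)
  have len: "length (fst u) = a" "length (snd u) = b" if "u \<in> C" for u
    using that sp by (cases u; auto simp: Z3Z9_space_def)+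
  let ?K = "{u \<in> C. low_digits u = low_digits (z39_zero a b)}"
  have 1: "card C = card (low_digits ` C) * card ?K"
  proof (rule card_code_hom_image[OF C])
    fix u v w assume uvw: "u \<in> C" "v \<in> C" "w \<in> C" "low_digits u = low_digits v"
    then show "low_digits (z39_add w u) = low_digits (z39_add w v)"
      using len[of u] len[of v] len[of w]
      by (cases u; cases v; cases w) (simp add: low_digits_def z39_add_Pair map_mod3_z9_add)
  qed
  have 2: "card (torsion a b C)
      = card (fst ` torsion a b C) * card {u \<in> torsion a b C. fst u = fst (z39_zero a b)}"
    by (rule card_code_hom_image[OF additive_code_torsion[OF C]]) (simp add: fst_z39_add)
  have "{u \<in> torsion a b C. fst u = fst (z39_zero a b)} = ?K"
  proof -
    have "u \<in> torsion a b C \<and> fst u = fst (z39_zero a b) \<longleftrightarrow> low_digits u = low_digits (z39_zero a b)"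
      if u: "u \<in> C" for u
      using triple_z39_eq_zero_iff[of u a b] u sp len[OF u]
      by (cases u) (auto simp: torsion_def low_digits_def z39_zero_def list_eq_iff_nth_eq)
    then show ?thesis by (auto simp: torsion_def)
  qed
  with 2 have "3 ^ (g + d) = 3 ^ k * card ?K" using code_type_card[OF type] by simp
  moreover have "3 ^ (g + 2 * d) = card (low_digits ` C) * card ?K"
    using 1 code_type_card[OF type] by simp
  ultimately have "card (low_digits ` C) * 3 ^ (g + d) = 3 ^ (g + 2 * d) * 3 ^ k" by simp
  also have "\<dots> = 3 ^ (d + k) * 3 ^ (g + d)" by (simp add: add_ac flip: power_add)
  finally show ?thesis by simp
qed

text \<open>Ternary coordinates and low digits add without carry, so they form a subspace
  themselves, and its product with \<open>Z\<close> contains all digit triples. \<open>Z\<close> is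
  kept general because the constructed codes have high digits vanishing on a tail of
  coordinates.\<close>

lemma code_rank_le_high_digits:
  assumes type: "code_type a b g d k C"
    and Z: "f3_subspace b Z" and high: "\<And>x y. (x, y) \<in> C \<Longrightarrow> map (\<lambda>t. t div 3) y \<in> Z"
  shows "3 ^ code_rank a b C \<le> 3 ^ (d + k) * card Z"
proof -
  have C: "additive_code a b C" using type by (simp add: code_type_def)
  have sp: "C \<subseteq> Z3Z9_space a b" using C by (simp add: additive_code_def)
  let ?T = "(\<lambda>((x, y), z). (x, y, z)) ` (low_digits ` C \<times> Z)"
  have T_iff: "(x, y, z) \<in> ?T \<longleftrightarrow> (x, y) \<in> low_digits ` C \<and> z \<in> Z" for x y z by force
  have low: "x \<in> f3_vecs a \<and> y \<in> f3_vecs b" if "(x, y) \<in> low_digits ` C" for x y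
    using that sp by (auto simp: low_digits_def Z3Z9_space_iff_nth f3_vecs_iff_nth)
  have "triple_subspace a b ?T"
    unfolding triple_subspace_def
  proof (intro conjI ballI)
    show "?T \<subseteq> triples a b"
      using low Z by (auto simp: triples_def f3_subspace_def)
    have "low_digits (z39_zero a b) = (replicate a 0, replicate b 0)"
      by (simp add: low_digits_def z39_zero_def)
    then show "(replicate a 0, replicate b 0, replicate b 0) \<in> ?T"
      unfolding T_iff using Z C by (metis additive_code_def f3_subspace_def imageI)
    fix s t assume "s \<in> ?T" "t \<in> ?T"
    then obtain u v z z' where st: "u \<in> C" "v \<in> C" "z \<in> Z" "z' \<in> Z"
      "s = (fst u, map (\<lambda>t. t mod 3) (snd u), z)" "t = (fst v, map (\<lambda>t. t mod 3) (snd v), z')"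
      by (auto simp: low_digits_def)
    have "length (snd u) = length (snd v)"
      using st sp by (cases u; cases v) (auto simp: Z3Z9_space_def)
    then have "triple_add s t = (fst (z39_add u v), map (\<lambda>t. t mod 3) (snd (z39_add u v)), f3_add z z')"
      by (simp add: st triple_add_def fst_z39_add snd_z39_add map_mod3_z9_add)
    moreover have "low_digits (z39_add u v) = (fst (z39_add u v), map (\<lambda>t. t mod 3) (snd (z39_add u v)))"
      by (simp add: low_digits_def case_prod_beta)
    moreover have "z39_add u v \<in> C" "f3_add z z' \<in> Z"
      using st C Z by (auto simp: additive_code_def f3_subspace_def)
    ultimately show "triple_add s t \<in> ?T" by (simp only: T_iff) (metis imageI)
  qed
  moreover have "digits ` C \<subseteq> ?T"
  proof (rule image_subsetI)
    fix u assume u: "u \<in> C"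
    obtain x y where xy: "u = (x, y)" by (cases u)
    have "(x, map (\<lambda>t. t mod 3) y) \<in> low_digits ` C"
      using u by (force simp: xy low_digits_def)
    then show "digits u \<in> ?T" using high[of x y] u T_iff by (simp add: xy digits_def)
  qed
  ultimately have "3 ^ code_rank a b C \<le> card ?T" by (rule code_rank_upper[OF sp])
  also have "\<dots> \<le> card (low_digits ` C \<times> Z)"
    using finite_subset[OF sp] Z finite_subset[of Z "f3_vecs b"]
    by (intro card_image_le) (auto simp: f3_subspace_def)
  also have "\<dots> = 3 ^ (d + k) * card Z"
    by (simp add: card_cartesian_product card_low_digits[OF type])
  finally show ?thesis .
qed

subsection \<open>The bound by cubic polynomials\<close>

text \<open>If all digits are fixed linear combinations of the functions \<open>e m\<close>, every
  digit triple is the image of the vector of values of these functions under one linear map, whose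
  domain has 3^(card I) elements.\<close>

lemma code_rank_le_functions:
  assumes fX: "f ` X \<subseteq> Z3Z9_space a b" and I: "finite I"
    and x: "\<And>c. c < a \<Longrightarrow> \<exists>s. \<forall>p\<in>X. [fst (f p) ! c = (\<Sum>m\<in>I. e m p * s m)] (mod 3)"
    and y: "\<And>c. c < b \<Longrightarrow> \<exists>s. \<forall>p\<in>X. [snd (f p) ! c = (\<Sum>m\<in>I. e m p * s m)] (mod 3)"
    and z: "\<And>c. c < b \<Longrightarrow> \<exists>s. \<forall>p\<in>X. [snd (f p) ! c div 3 = (\<Sum>m\<in>I. e m p * s m)] (mod 3)"
  shows "code_rank a b (f ` X) \<le> card I"
proof -
  obtain sx where sx: "\<And>c p. c < a \<Longrightarrow> p \<in> X \<Longrightarrow> [fst (f p) ! c = (\<Sum>m\<in>I. e m p * sx c m)] (mod 3)"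
    using x by metis
  obtain sy where sy: "\<And>c p. c < b \<Longrightarrow> p \<in> X \<Longrightarrow> [snd (f p) ! c = (\<Sum>m\<in>I. e m p * sy c m)] (mod 3)"
    using y by metis
  obtain sz where sz: "\<And>c p. c < b \<Longrightarrow> p \<in> X \<Longrightarrow> [snd (f p) ! c div 3 = (\<Sum>m\<in>I. e m p * sz c m)] (mod 3)"
    using z by metis
  define w where "w = (\<lambda>n sv t. map (\<lambda>c. (\<Sum>m\<in>I. t m * sv c m) mod (3::int)) [0..<n])"
  have w_vecs: "w n sv t \<in> f3_vecs n" for n sv t by (simp add: w_def f3_vecs_iff_nth)
  have w_zero: "w n sv (\<lambda>m\<in>I. 0) = replicate n 0" for n sv
    by (rule nth_equalityI) (simp_all add: w_def)
  have w_cong: "w n sv t = w n sv t'" if "\<And>m. m \<in> I \<Longrightarrow> [t m = t' m] (mod 3)" for n sv t t'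
  proof -
    have "[(\<Sum>m\<in>I. t m * sv c m) = (\<Sum>m\<in>I. t' m * sv c m)] (mod 3)" for c
      using that by (intro cong_sum cong_mult) auto
    then show ?thesis by (simp add: w_def cong_def)
  qed
  have w_add: "f3_add (w n sv t) (w n sv t') = w n sv (\<lambda>m\<in>I. (t m + t' m) mod 3)" for n sv t t'
  proof -
    have "f3_add (w n sv t) (w n sv t') = w n sv (\<lambda>m. t m + t' m)"
      by (rule nth_equalityI) (simp_all add: w_def mod_simps distrib_right sum.distrib)
    also have "\<dots> = w n sv (\<lambda>m\<in>I. (t m + t' m) mod 3)"
      by (rule w_cong) simp
    finally show ?thesis .
  qed
  \<comment> \<open>The linear map from vectors indexed by \<open>I\<close> to digit triples, with
    the coefficient families \<open>sx\<close>, \<open>sy\<close>, \<open>sz\<close> as its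
    matrix.\<close>
  define \<tau> where "\<tau> = (\<lambda>t. (w a sx t, w b sy t, w b sz t))"
  let ?S = "I \<rightarrow>\<^sub>E {0..2::int}"
  have mod3: "(t::int) mod 3 \<in> {0..2}" for t
    using pos_mod_bound[of 3 t] by (simp del: pos_mod_bound)
  have "triple_subspace a b (\<tau> ` ?S)"
    unfolding triple_subspace_def
  proof (intro conjI ballI)
    show "\<tau> ` ?S \<subseteq> triples a b" by (auto simp: \<tau>_def triples_def w_vecs)
    show "(replicate a 0, replicate b 0, replicate b 0) \<in> \<tau> ` ?S"
      by (rule image_eqI[of _ _ "\<lambda>m\<in>I. 0"]) (simp_all add: \<tau>_def w_zero)
    fix u v assume "u \<in> \<tau> ` ?S" "v \<in> \<tau> ` ?S"
    then obtain t t' where "u = \<tau> t" "v = \<tau> t'" by auto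
    then have "triple_add u v = \<tau> (\<lambda>m\<in>I. (t m + t' m) mod 3)"
      by (simp add: \<tau>_def triple_add_def w_add)
    then show "triple_add u v \<in> \<tau> ` ?S"
      using mod3 by (intro image_eqI[of _ _ "\<lambda>m\<in>I. (t m + t' m) mod 3"]) auto
  qed
  moreover have "digits ` f ` X \<subseteq> \<tau> ` ?S"
  proof -
    have "digits (f p) = \<tau> (\<lambda>m\<in>I. e m p mod 3)" if p: "p \<in> X" for p
    proof -
      obtain x y where xy: "f p = (x, y)" by (cases "f p")
      have sp: "(x, y) \<in> Z3Z9_space a b" using fX p xy by force
      have red: "w n sv (\<lambda>m\<in>I. e m p mod 3) = w n sv (\<lambda>m. e m p)" for n sv
        by (rule w_cong) simp
      have "x = w a sx (\<lambda>m. e m p)"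
        using sp sx[OF _ p] by (intro nth_equalityI) (auto simp: w_def xy Z3Z9_space_iff_nth cong_def)
      moreover have "map (\<lambda>t. t mod 3) y = w b sy (\<lambda>m. e m p)"
        using sp sy[OF _ p] by (intro nth_equalityI) (auto simp: w_def xy Z3Z9_space_iff_nth cong_def)
      moreover have "map (\<lambda>t. t div 3) y = w b sz (\<lambda>m. e m p)"
      proof (rule nth_equalityI)
        show "length (map (\<lambda>t. t div 3) y) = length (w b sz (\<lambda>m. e m p))"
          using sp by (simp add: w_def Z3Z9_space_iff_nth)
        fix i assume "i < length (map (\<lambda>t. t div 3) y)"
        then have i: "i < b" and yi: "0 \<le> y ! i div 3" "y ! i div 3 < 3" and "length y = b"
          using sp by (auto simp: Z3Z9_space_iff_nth)
        then show "map (\<lambda>t. t div 3) y ! i = w b sz (\<lambda>m. e m p) ! i"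
          using sz[OF i p] by (simp add: w_def xy cong_def)
      qed
      ultimately show ?thesis by (simp add: xy digits_def \<tau>_def red)
    qed
    then show ?thesis using mod3 by (fastforce intro!: image_eqI[of _ \<tau>])
  qed
  ultimately have "3 ^ code_rank a b (f ` X) \<le> card (\<tau> ` ?S)" by (rule code_rank_upper[OF fX])
  also have "\<dots> \<le> card ?S" using I by (intro card_image_le finite_PiE) auto
  also have "\<dots> = 3 ^ card I" using I by (simp add: card_PiE)
  finally show ?thesis by simp
qed

text \<open>
  A monomial indexes both a function of the parameters (\<open>monomial_eval\<close>) and a linear form
  (\<open>weight\<close>). Since \<open>\<mu>\<^sub>i\<^sup>3\<close> reduces to \<open>\<mu>\<^sub>i\<close>, the index \<open>Mixed i i\<close> is free; as a function it stands
  for the high digit of \<open>\<mu>\<^sub>i\<close>, as a form for \<open>3 \<mu>\<^sub>i\<close>, whose high digit is the low digit of \<open>\<mu>\<^sub>i\<close>.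
\<close>

datatype monomial = Squarefree "nat set" | Mixed nat nat | Square nat | Free nat

text \<open>The empty product is left out: every digit vanishes at the zero message.\<close>

definition monomials :: "nat \<Rightarrow> monomial set" where
  "monomials d = Squarefree ` {A. A \<subseteq> {..<d} \<and> card A \<in> {1, 2, 3}}
     \<union> case_prod Mixed ` ({..<d} \<times> {..<d}) \<union> Square ` {..<d}"

lemma finite_monomials [simp]: "finite (monomials d)"
proof -
  have "finite {A. A \<subseteq> {..<d} \<and> card A \<in> {1, 2, 3}}" by (rule finite_subset[of _ "Pow {..<d}"]) auto
  then show ?thesis by (simp add: monomials_def)
qed

text \<open>The binomials count multisets of indices: size 3 is three-element sets together with all
  \<open>Mixed i j\<close>, including i = j, and size 2 is pairs together with all
  \<open>Square i\<close>. The remaining summand \<open>d\<close> counts the singletons.\<close>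

lemma card_monomials: "card (monomials d) = d + ((d + 1) choose 2) + ((d + 2) choose 3)"
proof -
  let ?P = "\<lambda>n. {A. A \<subseteq> {..<d} \<and> card A = n}"
  have fin: "finite (?P n)" for n by (rule finite_subset[of _ "Pow {..<d}"]) auto
  have "{A. A \<subseteq> {..<d} \<and> card A \<in> {1, 2, 3}} = ?P 1 \<union> ?P 2 \<union> ?P 3" by auto
  moreover have "card (?P 1 \<union> ?P 2 \<union> ?P 3) = card (?P 1) + card (?P 2) + card (?P 3)"
    by (subst card_Un_disjoint; (use fin in auto)?)+
  ultimately have "card {A. A \<subseteq> {..<d} \<and> card A \<in> {1, 2, 3}} = d + (d choose 2) + (d choose 3)"
    using n_subsets[of "{..<d}"] by simp
  then have 1: "card (Squarefree ` {A. A \<subseteq> {..<d} \<and> card A \<in> {1, 2, 3}}) = d + (d choose 2) + (d choose 3)"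
    by (subst card_image) (auto simp: inj_on_def)
  have 2: "card (case_prod Mixed ` ({..<d} \<times> {..<d})) = d * d"
    by (subst card_image) (auto simp: inj_on_def card_cartesian_product)
  have 3: "card (Square ` {..<d}) = d" by (subst card_image) (auto simp: inj_on_def)
  have "card (monomials d) = d + (d choose 2) + (d choose 3) + d * d + d"
    unfolding monomials_def
    using finite_monomials[of d] unfolding monomials_def
    by (subst card_Un_disjoint, simp, simp, force, subst card_Un_disjoint, simp, simp, force,
        simp only: 1 2 3)
  moreover have "d * d = 2 * (d choose 2) + d"
    by (induction d) (simp_all add: numeral_2_eq_2)
  moreover have "(d + 1) choose 2 = d + (d choose 2)"
    by (simp add: numeral_2_eq_2)
  moreover have "(d + 2) choose 3 = (d choose 3) + 2 * (d choose 2) + d"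
    by (simp add: numeral_3_eq_3 numeral_2_eq_2)
  ultimately show ?thesis by simp
qed

definition monomial_eval :: "monomial \<Rightarrow> int list \<times> int list \<Rightarrow> int" where
  "monomial_eval m u = (case m of Squarefree A \<Rightarrow> \<Prod>i\<in>A. snd u ! i
     | Mixed i j \<Rightarrow> if i = j then snd u ! i div 3 else snd u ! i * snd u ! i * snd u ! j
     | Square i \<Rightarrow> snd u ! i * snd u ! i | Free i \<Rightarrow> fst u ! i)"

definition all_monomials :: "nat \<Rightarrow> nat \<Rightarrow> monomial set" where
  "all_monomials g d = monomials d \<union> Free ` {..<g}"

lemma finite_all_monomials [simp]: "finite (all_monomials g d)"
  by (simp add: all_monomials_def)

lemma card_all_monomials: "card (all_monomials g d) = g + d + ((d + 1) choose 2) + ((d + 2) choose 3)"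
proof -
  have "card (all_monomials g d) = card (monomials d) + card (Free ` {..<g})"
    unfolding all_monomials_def by (rule card_Un_disjoint) (auto simp: monomials_def)
  moreover have "card (Free ` {..<g}) = g" by (subst card_image) (auto simp: inj_on_def)
  ultimately show ?thesis by (simp add: card_monomials)
qed

section \<open>Functions of the message spanned by the monomials modulo 3\<close>

definition spanned :: "nat \<Rightarrow> nat \<Rightarrow> (int list \<times> int list \<Rightarrow> int) \<Rightarrow> bool" where
  "spanned g d h \<longleftrightarrow> (\<exists>s. \<forall>u\<in>Z3Z9_space g d.
     [h u = (\<Sum>m\<in>all_monomials g d. monomial_eval m u * s m)] (mod 3))"

lemma spanned_cong:
  assumes "spanned g d h" "\<And>u. u \<in> Z3Z9_space g d \<Longrightarrow> [h' u = h u] (mod 3)"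
  shows "spanned g d h'"
proof -
  obtain s where "\<forall>u\<in>Z3Z9_space g d.
      [h u = (\<Sum>m\<in>all_monomials g d. monomial_eval m u * s m)] (mod 3)"
    using assms(1) unfolding spanned_def by blast
  then show ?thesis
    unfolding spanned_def using cong_trans[OF assms(2)] by (intro exI[of _ s]) blast
qed

lemma spanned_add:
  assumes "spanned g d h" "spanned g d h'"
  shows "spanned g d (\<lambda>u. h u + h' u)"
proof -
  obtain s s' where
    "\<forall>u\<in>Z3Z9_space g d. [h u = (\<Sum>m\<in>all_monomials g d. monomial_eval m u * s m)] (mod 3)"
    "\<forall>u\<in>Z3Z9_space g d. [h' u = (\<Sum>m\<in>all_monomials g d. monomial_eval m u * s' m)] (mod 3)"
    using assms unfolding spanned_def by blast
  then show ?thesis unfolding spanned_def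
    by (intro exI[of _ "\<lambda>m. s m + s' m"]) (simp add: distrib_left sum.distrib cong_add)
qed

lemma spanned_scale:
  assumes "spanned g d h"
  shows "spanned g d (\<lambda>u. c * h u)"
proof -
  obtain s where
    s: "\<forall>u\<in>Z3Z9_space g d. [h u = (\<Sum>m\<in>all_monomials g d. monomial_eval m u * s m)] (mod 3)"
    using assms unfolding spanned_def by blast
  have "(\<Sum>m\<in>all_monomials g d. monomial_eval m u * (c * s m))
      = c * (\<Sum>m\<in>all_monomials g d. monomial_eval m u * s m)" for u
    by (simp add: sum_distrib_left mult_ac)
  then show ?thesis unfolding spanned_def
    using s by (intro exI[of _ "\<lambda>m. c * s m"]) (simp add: cong_scalar_left)
qed

lemma spanned_sum:
  assumes "finite J" "\<And>j. j \<in> J \<Longrightarrow> spanned g d (h j)"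
  shows "spanned g d (\<lambda>u. \<Sum>j\<in>J. h j u)"
  using assms
proof (induction J)
  case empty
  then show ?case unfolding spanned_def by (intro exI[of _ "\<lambda>_. 0"]) simp
next
  case (insert j J)
  then show ?case by (simp add: spanned_add)
qed

lemma spanned_monomial:
  assumes "m \<in> all_monomials g d"
  shows "spanned g d (monomial_eval m)"
proof -
  have "(\<Sum>m'\<in>all_monomials g d. monomial_eval m' u * of_bool (m' = m)) = monomial_eval m u" for u
    using assms by (simp add: of_bool_def if_distrib cong: if_cong)
  then show ?thesis unfolding spanned_def by (intro exI[of _ "\<lambda>m'. of_bool (m' = m)"]) simp
qed

lemma cube_cong_3: "[t * t * t = t] (mod (3::int))"
proof -
  have "t mod 3 = 0 \<or> t mod 3 = 1 \<or> t mod 3 = 2" by presburger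
  then have "[t mod 3 * (t mod 3) * (t mod 3) = t mod 3] (mod 3)" by (auto simp: cong_def)
  moreover have "[t mod 3 * (t mod 3) * (t mod 3) = t * t * t] (mod 3)"
    by (intro cong_mult cong_mod_leftI cong_refl)
  ultimately show ?thesis by (metis cong_mod_right cong_sym cong_trans)
qed

lemma spanned_degree_1:
  assumes "i < d"
  shows "spanned g d (\<lambda>u. snd u ! i)"
  using assms by (intro spanned_cong[OF spanned_monomial[of "Squarefree {i}"]])
    (auto simp: all_monomials_def monomials_def monomial_eval_def)

lemma spanned_degree_2:
  assumes "i < d" "j < d"
  shows "spanned g d (\<lambda>u. snd u ! i * snd u ! j)"
proof (cases "i = j")
  case True
  then show ?thesis using assms by (intro spanned_cong[OF spanned_monomial[of "Square i"]])
    (auto simp: all_monomials_def monomials_def monomial_eval_def)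
next
  case False
  then show ?thesis using assms by (intro spanned_cong[OF spanned_monomial[of "Squarefree {i, j}"]])
    (auto simp: all_monomials_def monomials_def monomial_eval_def)
qed

lemma spanned_degree_3:
  assumes "i < d" "j < d" "k < d"
  shows "spanned g d (\<lambda>u. snd u ! i * snd u ! j * snd u ! k)"
proof -
  have mixed: "spanned g d (\<lambda>u. snd u ! i * snd u ! i * snd u ! j)" if "i < d" "j < d" for i j
  proof (cases "i = j")
    case True
    then show ?thesis
      using that by (intro spanned_cong[OF spanned_degree_1[of i]]) (auto simp: cube_cong_3)
  next
    case False
    then show ?thesis using that
      by (intro spanned_cong[OF spanned_monomial[of "Mixed i j"]])
        (auto simp: all_monomials_def monomials_def monomial_eval_def)
  qed
  consider "i = j" | "i = k" | "j = k" | "distinct [i, j, k]" by auto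
  then show ?thesis
  proof cases
    case 4
    then show ?thesis using assms
      by (intro spanned_cong[OF spanned_monomial[of "Squarefree {i, j, k}"]])
        (auto simp: all_monomials_def monomials_def monomial_eval_def mult.assoc)
  next
    case 1
    then show ?thesis using mixed[of i k] assms by simp
  next
    case 2
    then show ?thesis using mixed[of i j] assms by (simp add: mult_ac)
  next
    case 3
    then show ?thesis using mixed[of j i] assms by (simp add: mult_ac)
  qed
qed

text \<open>Two ternary digits produce a carry unless one of them is 0 or both are 1, which are the
  zeros of s t (s + t + 1) modulo 3. Carry and polynomial depend on residues modulo 3 only, so the
  formula extends to all integers.\<close>

lemma carry_cong: "[(s + t) div 3 = s div 3 + t div 3 - s * t * (s + t + 1)] (mod (3::int))"
proof -
  have "(s mod 3 = 0 \<or> s mod 3 = 1 \<or> s mod 3 = 2) \<and> (t mod 3 = 0 \<or> t mod 3 = 1 \<or> t mod 3 = 2)"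
    by presburger
  then have "[(s mod 3 + t mod 3) div 3
      = 0 - (s mod 3) * (t mod 3) * (s mod 3 + t mod 3 + 1)] (mod (3::int))"
    by (auto simp: cong_def)
  also have "[0 - (s mod 3) * (t mod 3) * (s mod 3 + t mod 3 + 1) = 0 - s * t * (s + t + 1)] (mod 3)"
    by (intro cong_diff cong_mult cong_add cong_mod_leftI cong_refl)
  finally have "[s div 3 + t div 3 + (s mod 3 + t mod 3) div 3
      = s div 3 + t div 3 + (0 - s * t * (s + t + 1))] (mod 3)"
    by (simp only: cong_add_lcancel)
  moreover have "(s + t) div 3 = s div 3 + t div 3 + (s mod 3 + t mod 3) div 3"
    by (rule div_add1_eq)
  ultimately show ?thesis by simp
qed

lemma div_3_cong: "[s = t] (mod 9) \<Longrightarrow> [s div 3 = t div 3] (mod (3::int))"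
proof -
  assume "[s = t] (mod 9)"
  then obtain m where "s = t + 9 * m" by (metis cong_iff_lin cong_sym)
  then have "s div 3 = t div 3 + 3 * m" by simp
  then show ?thesis by (simp add: cong_def)
qed

text \<open>Adding one more copy of \<mu>_i to n copies carries -n (n + 1) \<mu>_i^3 - n
  \<mu>_i^2.\<close>

lemma spanned_multiple_div:
  assumes "i < d"
  shows "spanned g d (\<lambda>u. (int n * snd u ! i) div 3)"
proof (induction n)
  case 0
  show ?case unfolding spanned_def by (intro exI[of _ "\<lambda>_. 0"]) simp
next
  case (Suc n)
  have "spanned g d (\<lambda>u. snd u ! i div 3)"
    using assms by (intro spanned_cong[OF spanned_monomial[of "Mixed i i"]])
      (auto simp: all_monomials_def monomials_def monomial_eval_def)
  then have *: "spanned g d (\<lambda>u. (int n * snd u ! i) div 3 + snd u ! i div 3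
      + (- (int n * (int n + 1)) * (snd u ! i * snd u ! i * snd u ! i) + - int n * (snd u ! i * snd u ! i)))"
    using Suc.IH assms
    by (intro spanned_add spanned_scale spanned_degree_2 spanned_degree_3)
  show ?case
  proof (rule spanned_cong[OF *])
    fix u
    show "[(int (Suc n) * snd u ! i) div 3 = (int n * snd u ! i) div 3 + snd u ! i div 3
      + (- (int n * (int n + 1)) * (snd u ! i * snd u ! i * snd u ! i) + - int n * (snd u ! i * snd u ! i))] (mod 3)"
      using carry_cong[of "int n * snd u ! i" "snd u ! i"] by (simp add: algebra_simps)
  qed
qed

text \<open>With S the part of the form already treated and T the next term, the carry is -S^2 T - S
  T^2 - S T. It involves the linear values S and T rather than high digits accumulated so far, so
  the degree stays at most 3.\<close>

lemma spanned_linear_div: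
  assumes "n \<le> d"
  shows "spanned g d (\<lambda>u. (\<Sum>j<n. int (B j) * snd u ! j) div 3)"
  using assms
proof (induction n)
  case 0
  show ?case unfolding spanned_def by (intro exI[of _ "\<lambda>_. 0"]) simp
next
  case (Suc n)
  have *: "spanned g d (\<lambda>u. (\<Sum>j<n. int (B j) * snd u ! j) div 3 + (int (B n) * snd u ! n) div 3
    + ((\<Sum>i<n. \<Sum>j<n. - (int (B i) * int (B j) * int (B n)) * (snd u ! i * snd u ! j * snd u ! n))
     + (\<Sum>i<n. - (int (B i) * int (B n) * int (B n)) * (snd u ! i * snd u ! n * snd u ! n))
     + (\<Sum>i<n. - (int (B i) * int (B n)) * (snd u ! i * snd u ! n))))"
    using Suc by (intro spanned_add spanned_sum spanned_scale spanned_degree_2 spanned_degree_3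
        spanned_multiple_div) auto
  show ?case
  proof (rule spanned_cong[OF *])
    fix u
    let ?s = "\<Sum>j<n. int (B j) * snd u ! j" and ?t = "int (B n) * snd u ! n"
    have "(\<Sum>i<n. \<Sum>j<n. - (int (B i) * int (B j) * int (B n)) * (snd u ! i * snd u ! j * snd u ! n))
        = - (?s * ?s * ?t)"
      by (simp add: sum_product sum_distrib_left sum_distrib_right sum_negf mult_ac)
    moreover have "(\<Sum>i<n. - (int (B i) * int (B n) * int (B n)) * (snd u ! i * snd u ! n * snd u ! n))
        = - (?s * ?t * ?t)"
      by (simp add: sum_distrib_left sum_distrib_right sum_negf mult_ac)
    moreover have "(\<Sum>i<n. - (int (B i) * int (B n)) * (snd u ! i * snd u ! n)) = - (?s * ?t)"
      by (simp add: sum_distrib_left sum_distrib_right sum_negf mult_ac)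
    moreover have "[(\<Sum>j<Suc n. int (B j) * snd u ! j) div 3
        = ?s div 3 + ?t div 3 + (- (?s * ?s * ?t) + - (?s * ?t * ?t) + - (?s * ?t))] (mod 3)"
      using carry_cong[of ?s ?t] by (simp add: algebra_simps)
    ultimately show "[(\<Sum>j<Suc n. int (B j) * snd u ! j) div 3
      = (\<Sum>j<n. int (B j) * snd u ! j) div 3 + (int (B n) * snd u ! n) div 3
      + ((\<Sum>i<n. \<Sum>j<n. - (int (B i) * int (B j) * int (B n)) * (snd u ! i * snd u ! j * snd u ! n))
     + (\<Sum>i<n. - (int (B i) * int (B n) * int (B n)) * (snd u ! i * snd u ! n * snd u ! n))
     + (\<Sum>i<n. - (int (B i) * int (B n)) * (snd u ! i * snd u ! n)))] (mod 3)"
      by (simp only:)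
  qed
qed

text \<open>The coefficients are the values of \<chi> on the unit messages. A unit message in a
  ternary position has order 3, which gives the condition on \<open>A\<close>; for n = 9 it says
  that 3 divides \<open>A i\<close>.\<close>

lemma z39_functional_linear:
  fixes \<chi> :: "int list \<times> int list \<Rightarrow> int"
  assumes add: "\<And>u v. u \<in> Z3Z9_space g d \<Longrightarrow> v \<in> Z3Z9_space g d \<Longrightarrow>
    [\<chi> (z39_add u v) = \<chi> u + \<chi> v] (mod n)"
  obtains A B where "\<And>u. u \<in> Z3Z9_space g d \<Longrightarrow>
      [\<chi> u = (\<Sum>i<g. A i * fst u ! i) + (\<Sum>j<d. B j * snd u ! j)] (mod n)"
    and "\<And>i. i < g \<Longrightarrow> [3 * A i = 0] (mod n)"
proof
  define E where "E = (\<lambda>i. ((replicate g 0)[i := 1 :: int], replicate d (0::int)))"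
  define F where "F = (\<lambda>j. (replicate g (0::int), (replicate d 0)[j := 1 :: int]))"
  have E_sp: "E i \<in> Z3Z9_space g d" and F_sp: "F i \<in> Z3Z9_space g d" for i
    by (cases "i < g"; cases "i < d"; auto simp: E_def F_def Z3Z9_space_iff_nth nth_list_update)+
  have zero: "[\<chi> (z39_zero g d) = 0] (mod n)"
  proof -
    have "[\<chi> (z39_zero g d) + 0 = \<chi> (z39_zero g d) + \<chi> (z39_zero g d)] (mod n)"
      using add[OF z39_zero_in_space z39_zero_in_space] z39_add_zero[OF z39_zero_in_space]
      by simp
    then have "[0 = \<chi> (z39_zero g d)] (mod n)" by (simp only: cong_add_lcancel)
    then show ?thesis by (rule cong_sym)
  qed
  show "[3 * \<chi> (E i) = 0] (mod n)" if "i < g" for i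
  proof -
    have "z39_add (E i) (z39_add (E i) (E i)) = z39_zero g d"
      unfolding triple_z39_eq_zero_iff[OF E_sp] by (simp add: E_def)
    then have "[0 = \<chi> (E i) + \<chi> (z39_add (E i) (E i))] (mod n)"
      using add[OF E_sp z39_add_in_space[OF E_sp E_sp], of i i i] zero
      by (metis cong_sym cong_trans)
    also have "[\<chi> (E i) + \<chi> (z39_add (E i) (E i)) = \<chi> (E i) + (\<chi> (E i) + \<chi> (E i))] (mod n)"
      by (intro cong_add cong_refl add E_sp)
    also have "\<chi> (E i) + (\<chi> (E i) + \<chi> (E i)) = 3 * \<chi> (E i)" by simp
    finally show ?thesis by (rule cong_sym)
  qed
  have upd: "(\<Sum>l<m. A l * (x[i := x ! i - 1]) ! l) = (\<Sum>l<m. A l * x ! l) - A i"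
    if "i < m" "length x = m" for i m and x :: "int list" and A :: "nat \<Rightarrow> int"
  proof -
    have "(\<Sum>l<m. A l * (x[i := x ! i - 1]) ! l) = (\<Sum>l<m. A l * x ! l - (if l = i then A l else 0))"
      using that by (intro sum.cong) (auto simp: nth_list_update algebra_simps)
    then show ?thesis using that by (simp add: sum_subtractf)
  qed
  have "(x, y) \<in> Z3Z9_space g d \<Longrightarrow>
      [\<chi> (x, y) = (\<Sum>i<g. \<chi> (E i) * x ! i) + (\<Sum>j<d. \<chi> (F j) * y ! j)] (mod n)" for x y
  \<comment> \<open>Each step removes one unit message, lowering the coordinate sum by 1. The factor
    1 lets \<open>upd\<close> with constant coefficients compute this decrease.\<close>
  proof (induction "nat ((\<Sum>i<g. 1 * x ! i) + (\<Sum>j<d. 1 * y ! j))" arbitrary: x y rule: less_induct)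
    case less
    have len: "length x = g" "length y = d"
      and xb: "\<And>i. i < g \<Longrightarrow> 0 \<le> x ! i" and yb: "\<And>i. i < d \<Longrightarrow> 0 \<le> y ! i"
      using less.prems by (auto simp: Z3Z9_space_iff_nth)
    have nonneg: "0 \<le> (\<Sum>i<g. 1 * x ! i)" "0 \<le> (\<Sum>j<d. 1 * y ! j)"
      using xb yb by (auto intro!: sum_nonneg)
    consider (x) i where "i < g" "0 < x ! i" | (y) j where "j < d" "0 < y ! j"
      | (none) "\<And>i. i < g \<Longrightarrow> x ! i = 0" "\<And>j. j < d \<Longrightarrow> y ! j = 0"
    proof -
      have "(\<exists>i<g. 0 < x ! i) \<or> (\<exists>j<d. 0 < y ! j) \<or> ((\<forall>i<g. x ! i = 0) \<and> (\<forall>j<d. y ! j = 0))"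
        using xb yb by (metis order_le_less)
      then show thesis using that by blast
    qed
    then show ?case
    proof cases
      case (x i)
      let ?x = "x[i := x ! i - 1]"
      have sp: "(?x, y) \<in> Z3Z9_space g d"
        using less.prems x by (auto simp: Z3Z9_space_iff_nth nth_list_update)
      have "x ! i \<le> (\<Sum>l<g. 1 * x ! l)"
        using x(1) xb by (auto intro!: member_le_sum)
      then have "[\<chi> (?x, y) = (\<Sum>i<g. \<chi> (E i) * ?x ! i) + (\<Sum>j<d. \<chi> (F j) * y ! j)] (mod n)"
        using x nonneg upd[OF x(1) len(1), of "\<lambda>_. 1"] by (intro less.hyps[OF _ sp]) linarith
      moreover have "z39_add (?x, y) (E i) = (x, y)"
        using x less.prems
        by (auto simp: E_def z39_add_Pair Z3Z9_space_iff_nth nth_list_update intro!: nth_equalityI)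
      ultimately have "[\<chi> (x, y) = (\<Sum>i<g. \<chi> (E i) * ?x ! i) + (\<Sum>j<d. \<chi> (F j) * y ! j) + \<chi> (E i)] (mod n)"
        using cong_trans[OF add[OF sp E_sp[of i]] cong_add[OF _ cong_refl]] by simp
      then show ?thesis by (simp only: upd[OF x(1) len(1), of "\<lambda>i. \<chi> (E i)"]) (simp add: algebra_simps)
    next
      case (y j)
      let ?y = "y[j := y ! j - 1]"
      have sp: "(x, ?y) \<in> Z3Z9_space g d"
        using less.prems y by (auto simp: Z3Z9_space_iff_nth nth_list_update)
      have "y ! j \<le> (\<Sum>l<d. 1 * y ! l)"
        using y(1) yb by (auto intro!: member_le_sum)
      then have "[\<chi> (x, ?y) = (\<Sum>i<g. \<chi> (E i) * x ! i) + (\<Sum>j<d. \<chi> (F j) * ?y ! j)] (mod n)"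
        using y nonneg upd[OF y(1) len(2), of "\<lambda>_. 1"] by (intro less.hyps[OF _ sp]) linarith
      moreover have "z39_add (x, ?y) (F j) = (x, y)"
        using y less.prems
        by (auto simp: F_def z39_add_Pair Z3Z9_space_iff_nth nth_list_update intro!: nth_equalityI)
      ultimately have "[\<chi> (x, y) = (\<Sum>i<g. \<chi> (E i) * x ! i) + (\<Sum>j<d. \<chi> (F j) * ?y ! j) + \<chi> (F j)] (mod n)"
        using cong_trans[OF add[OF sp F_sp[of j]] cong_add[OF _ cong_refl]] by simp
      then show ?thesis by (simp only: upd[OF y(1) len(2), of "\<lambda>i. \<chi> (F i)"]) (simp add: algebra_simps)
    next
      case none
      then have "(x, y) = z39_zero g d"
        using len by (auto simp: z39_zero_def intro!: nth_equalityI)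
      then show ?thesis using zero none by simp
    qed
  qed
  then show "[\<chi> u = (\<Sum>i<g. \<chi> (E i) * fst u ! i) + (\<Sum>j<d. \<chi> (F j) * snd u ! j)] (mod n)"
    if "u \<in> Z3Z9_space g d" for u
    using that by (cases u) simp
qed

text \<open>The isomorphism from the model group is linear in the parameters in each coordinate.
  Modulo 9 its ternary part is a multiple of 3, which adds a linear term to the high digit; the part
  in \<mu> is covered by the carry analysis.\<close>

lemma code_rank_le_monomials:
  assumes type: "code_type a b g d k C"
  shows "code_rank a b C \<le> g + d + ((d + 1) choose 2) + ((d + 2) choose 3)"
proof -
  let ?X = "Z3Z9_space g d"
  obtain f where C: "additive_code a b C" and f: "f ` ?X = C"
    and hom: "\<forall>u\<in>?X. \<forall>v\<in>?X. f (z39_add u v) = z39_add (f u) (f v)"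
    using type unfolding code_type_def bij_betw_def by blast
  have sp: "f ` ?X \<subseteq> Z3Z9_space a b" using C f by (simp add: additive_code_def)
  have len: "length (fst (f u)) = a" "length (snd (f u)) = b" if "u \<in> ?X" for u
    using sp that by (cases "f u"; force simp: Z3Z9_space_def)+
  have free: "spanned g d (\<lambda>u. fst u ! i)" if "i < g" for i
    using that by (intro spanned_cong[OF spanned_monomial[of "Free i"]])
      (auto simp: all_monomials_def monomial_eval_def)
  have lin: "spanned g d (\<lambda>u. (\<Sum>i<g. A i * fst u ! i) + (\<Sum>j<d. B j * snd u ! j))" for A B
    by (intro spanned_add spanned_sum spanned_scale free spanned_degree_1) auto
  have X: "spanned g d (\<lambda>u. fst (f u) ! c)" if "c < a" for c
  proof -
    have "[fst (f (z39_add u v)) ! c = fst (f u) ! c + fst (f v) ! c] (mod 3)"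
      if "u \<in> ?X" "v \<in> ?X" for u v
      using that \<open>c < a\<close> len hom by (simp add: fst_z39_add cong_def)
    then obtain A B where "\<And>u. u \<in> ?X \<Longrightarrow>
      [fst (f u) ! c = (\<Sum>i<g. A i * fst u ! i) + (\<Sum>j<d. B j * snd u ! j)] (mod 3)"
      by (rule z39_functional_linear[where \<chi> = "\<lambda>u. fst (f u) ! c"]) blast+
    then show ?thesis by (rule spanned_cong[OF lin])
  qed
  have YZ: "spanned g d (\<lambda>u. snd (f u) ! c)" "spanned g d (\<lambda>u. snd (f u) ! c div 3)" if "c < b" for c
  proof -
    have "[snd (f (z39_add u v)) ! c = snd (f u) ! c + snd (f v) ! c] (mod 9)"
      if "u \<in> ?X" "v \<in> ?X" for u v
      using that \<open>c < b\<close> len hom by (simp add: snd_z39_add cong_def)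
    then obtain A B where AB: "\<And>u. u \<in> ?X \<Longrightarrow>
      [snd (f u) ! c = (\<Sum>i<g. A i * fst u ! i) + (\<Sum>j<d. B j * snd u ! j)] (mod 9)"
      and A: "\<And>i. i < g \<Longrightarrow> [3 * A i = 0] (mod 9)"
      by (rule z39_functional_linear[where \<chi> = "\<lambda>u. snd (f u) ! c"]) blast+
    have "[snd (f u) ! c = (\<Sum>i<g. A i * fst u ! i) + (\<Sum>j<d. B j * snd u ! j)] (mod 3)"
      if "u \<in> ?X" for u
      using AB[OF that] by (rule cong_dvd_modulus) simp
    then show "spanned g d (\<lambda>u. snd (f u) ! c)" by (rule spanned_cong[OF lin])
    \<comment> \<open>Coefficients may be reduced modulo 9, as the high digit modulo 3 sees its
      argument only modulo 9; this makes them natural numbers, as \<open>spanned_linear_div\<close>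
      expects.\<close>
    define B' where "B' = (\<lambda>j. nat (B j mod 9))"
    have B': "int (B' j) = B j mod 9" for j by (simp add: B'_def)
    have A3: "3 dvd A i" if "i < g" for i
      using A[OF that] unfolding cong_def by presburger
    have *: "spanned g d (\<lambda>u. (\<Sum>i<g. (A i div 3) * fst u ! i) + (\<Sum>j<d. int (B' j) * snd u ! j) div 3)"
      by (intro spanned_add spanned_sum spanned_scale spanned_linear_div free) auto
    show "spanned g d (\<lambda>u. snd (f u) ! c div 3)"
    proof (rule spanned_cong[OF *])
      fix u assume u: "u \<in> ?X"
      let ?l = "\<Sum>i<g. (A i div 3) * fst u ! i" and ?m = "\<Sum>j<d. int (B' j) * snd u ! j"
      have "(\<Sum>i<g. A i * fst u ! i) = 3 * ?l"
        unfolding sum_distrib_left using A3 by (intro sum.cong) (simp_all flip: mult.assoc)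
      moreover have "[(\<Sum>j<d. B j * snd u ! j) = ?m] (mod 9)"
        by (intro cong_sum cong_mult cong_refl) (simp add: B')
      ultimately have "[snd (f u) ! c = 3 * ?l + ?m] (mod 9)"
        using cong_trans[OF AB[OF u] cong_add[OF cong_refl]] by simp
      then have "[snd (f u) ! c div 3 = (3 * ?l + ?m) div 3] (mod 3)" by (rule div_3_cong)
      then show "[snd (f u) ! c div 3 = ?l + ?m div 3] (mod 3)" by simp
    qed
  qed
  have "code_rank a b (f ` ?X) \<le> card (all_monomials g d)"
    using X YZ by (intro code_rank_le_functions[where e = monomial_eval] sp finite_all_monomials)
      (auto simp: spanned_def)
  then show ?thesis by (simp add: f card_all_monomials)
qed

subsection \<open>Independence of the high digits of linear forms\<close>

text \<open>The exponent of \<mu>_l in the monomial. In particular \<open>Mixed i i\<close> has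
  exponent 3 at i, which is the form 3 \<mu>_i.\<close>

fun weight :: "monomial \<Rightarrow> nat \<Rightarrow> int" where
  "weight (Squarefree A) l = of_bool (l \<in> A)"
| "weight (Mixed i j) l = 2 * of_bool (l = i) + of_bool (l = j)"
| "weight (Square i) l = 2 * of_bool (l = i)"
| "weight (Free i) l = 0"

definition form :: "nat \<Rightarrow> monomial \<Rightarrow> (nat \<Rightarrow> int) \<Rightarrow> int" where
  "form d m \<mu> = (\<Sum>l<d. weight m l * \<mu> l)"

text \<open>The positions may coincide, and their values then add; evaluations with fewer variables
  repeat a position with value 0.\<close>

lemma form_three_points:
  assumes "i < d" "j < d" "k < d"
  shows "form d m (\<lambda>l. x * of_bool (l = i) + y * of_bool (l = j) + z * of_bool (l = k))
    = x * weight m i + y * weight m j + z * weight m k"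
proof -
  have "form d m (\<lambda>l. x * of_bool (l = i) + y * of_bool (l = j) + z * of_bool (l = k))
    = (\<Sum>l<d. (if l = i then x * weight m l else 0) + (if l = j then y * weight m l else 0)
        + (if l = k then z * weight m l else 0))"
    unfolding form_def by (intro sum.cong) (auto simp: algebra_simps)
  then show ?thesis using assms by (simp add: sum.distrib)
qed

text \<open>A message with few nonzero parameters sees only the weights at these positions, and
  alternating sums of such evaluations remove every form that misses one of them. Working down from
  three positions to one, the forms settled before drop out and a small system modulo 3
  remains.\<close>

lemma forms_div_3_independent:
  assumes C: "\<And>m. m \<in> monomials d \<Longrightarrow> C m \<in> {0, 1, 2 :: int}"
    and rel: "\<And>\<mu>. (\<And>l. \<mu> l \<in> {0..8}) \<Longrightarrow> 3 dvd (\<Sum>m\<in>monomials d. C m * (form d m \<mu> div 3))"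
    and m: "m \<in> monomials d"
  shows "C m = 0"
proof -
  define q where "q = (\<lambda>i j k x y z m. (x * weight m i + y * weight m j + z * weight m k) div 3)"
  \<comment> \<open>The bound on the sum keeps the parameters within 0..8 even when positions
    coincide.\<close>
  have Q: "3 dvd (\<Sum>m\<in>monomials d. C m * q i j k x y z m)"
    if "i < d" "j < d" "k < d" "0 \<le> x" "0 \<le> y" "0 \<le> z" "x + y + z \<le> 8" for i j k x y z
  proof -
    let ?\<mu> = "\<lambda>l. x * of_bool (l = i) + y * of_bool (l = j) + z * of_bool (l = k)"
    have "?\<mu> l \<in> {0..8}" for l using that by (auto simp: of_bool_def)
    then have "3 dvd (\<Sum>m\<in>monomials d. C m * (form d m ?\<mu> div 3))" by (rule rel)
    then show ?thesis unfolding form_three_points[OF that(1,2,3)] q_def .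
  qed
  have C0: "3 dvd C m \<Longrightarrow> C m = 0" if "m \<in> monomials d" for m
    using C[OF that] by auto
  text \<open>Third, second and first differences isolate the triples, the pairs and the single variables.\<close>
  have triple: "C (Squarefree {i, j, k}) = 0"
    if ijk: "i < d" "j < d" "k < d" "i \<noteq> j" "i \<noteq> k" "j \<noteq> k" for i j k
  proof -
    let ?D = "\<lambda>m. q i j k 1 1 1 m - q i j k 1 1 0 m - q i j k 1 0 1 m - q i j k 0 1 1 m
      + q i j k 1 0 0 m + q i j k 0 1 0 m + q i j k 0 0 1 m"
    have mem: "Squarefree {i, j, k} \<in> monomials d" using ijk by (auto simp: monomials_def)
    \<comment> \<open>\<open>?D\<close> is the third difference at the origin, where
      \<open>q\<close> vanishes. If one weight is 0, its terms cancel in pairs.\<close>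
    have D0: "?D m = 0" if "weight m i = 0 \<or> weight m j = 0 \<or> weight m k = 0" for m
      using that by (elim disjE) (simp_all add: q_def)
    have D: "?D m = of_bool (m = Squarefree {i, j, k})" if m: "m \<in> monomials d" for m
    proof (cases m)
      case (Squarefree A)
      then have A: "A \<subseteq> {..<d}" "card A \<le> 3" using m by (auto simp: monomials_def)
      show ?thesis
      proof (cases "{i, j, k} \<subseteq> A")
        case True
        then have "A = {i, j, k}"
          using A ijk card_seteq[of A "{i, j, k}"] finite_subset[OF A(1)] by auto
        then show ?thesis using Squarefree ijk by (simp add: q_def)
      next
        case False
        then have "weight m i = 0 \<or> weight m j = 0 \<or> weight m k = 0" by (auto simp: Squarefree)
        moreover have "m \<noteq> Squarefree {i, j, k}" using False by (auto simp: Squarefree)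
        ultimately show ?thesis using D0 by simp
      qed
    next
      case (Mixed p r)
      then have "weight m i = 0 \<or> weight m j = 0 \<or> weight m k = 0" using ijk by auto
      then show ?thesis using Mixed D0 by simp
    next
      case (Square p)
      then have "weight m i = 0 \<or> weight m j = 0 \<or> weight m k = 0" using ijk by auto
      then show ?thesis using Square D0 by simp
    next
      case (Free p)
      then have "weight m i = 0 \<or> weight m j = 0 \<or> weight m k = 0" by simp
      then show ?thesis using Free D0 by simp
    qed
    have "3 dvd (\<Sum>m\<in>monomials d. C m * q i j k 1 1 1 m) - (\<Sum>m\<in>monomials d. C m * q i j k 1 1 0 m)
      - (\<Sum>m\<in>monomials d. C m * q i j k 1 0 1 m) - (\<Sum>m\<in>monomials d. C m * q i j k 0 1 1 m)
      + (\<Sum>m\<in>monomials d. C m * q i j k 1 0 0 m) + (\<Sum>m\<in>monomials d. C m * q i j k 0 1 0 m)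
      + (\<Sum>m\<in>monomials d. C m * q i j k 0 0 1 m)"
      using ijk by (intro dvd_add dvd_diff Q) auto
    also have "\<dots> = (\<Sum>m\<in>monomials d. C m * ?D m)"
      by (simp add: sum.distrib sum_subtractf distrib_left right_diff_distrib)
    also have "\<dots> = (\<Sum>m\<in>monomials d. if m = Squarefree {i, j, k} then C m else 0)"
      using D by (intro sum.cong) auto
    also have "\<dots> = C (Squarefree {i, j, k})" using mem by simp
    finally show ?thesis using C0[OF mem] by simp
  qed
  have pair: "C (Squarefree {i, j}) = 0 \<and> C (Mixed i j) = 0 \<and> C (Mixed j i) = 0"
    if ij: "i < d" "j < d" "i \<noteq> j" for i j
  proof -
    let ?E = "\<lambda>x y m. q i j i x y 0 m - q i j i x 0 0 m - q i j i 0 y 0 m"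
    let ?S = "{Squarefree {i, j}, Mixed i j, Mixed j i}"
    have mem: "?S \<subseteq> monomials d" using ij by (auto simp: monomials_def)
    have E0: "?E x y m = 0" if "weight m i = 0 \<or> weight m j = 0" for m x y
      using that by (elim disjE) (simp_all add: q_def)
    have other: "C m * ?E x y m = 0" if m: "m \<in> monomials d - ?S" for m x y
    proof (cases m)
      case (Squarefree A)
      then have A: "A \<subseteq> {..<d}" "card A \<in> {1, 2, 3}" "A \<noteq> {i, j}" using m by (auto simp: monomials_def)
      have fin: "finite A" by (rule finite_subset[OF A(1)]) simp
      show ?thesis
      proof (cases "{i, j} \<subseteq> A")
        case True
        have "card A = 3"
        proof (rule ccontr)
          assume "card A \<noteq> 3"
          then have "card A \<le> card {i, j}" using A(2) ij by auto
          then show False using card_seteq[OF fin True] A(3) by simp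
        qed
        then have "card (A - {i, j}) = 1" using True fin ij by (simp add: card_Diff_subset)
        then obtain k where k: "A - {i, j} = {k}" by (auto simp: card_1_singleton_iff)
        then have "k \<in> A" "k \<noteq> i" "k \<noteq> j" by auto
        moreover have "A = {i, j, k}" using k True by auto
        ultimately have "C m = 0" using triple[of i j k] ij A(1) Squarefree by auto
        then show ?thesis by simp
      next
        case False
        then have "weight m i = 0 \<or> weight m j = 0" by (auto simp: Squarefree)
        then show ?thesis using E0 by simp
      qed
    next
      case (Mixed p r)
      then have "weight m i = 0 \<or> weight m j = 0" using ij m by auto
      then show ?thesis using E0 by simp
    next
      case (Square p)
      then have "weight m i = 0 \<or> weight m j = 0" using ij by auto
      then show ?thesis using E0 by simp
    next
      case (Free p)
      then show ?thesis using E0 by simp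
    qed
    have main: "3 dvd C (Squarefree {i, j}) * ?E x y (Squarefree {i, j})
        + (C (Mixed i j) * ?E x y (Mixed i j) + C (Mixed j i) * ?E x y (Mixed j i))"
      if "0 \<le> x" "0 \<le> y" "x + y \<le> 8" for x y
    proof -
      have "3 dvd (\<Sum>m\<in>monomials d. C m * q i j i x y 0 m) - (\<Sum>m\<in>monomials d. C m * q i j i x 0 0 m)
        - (\<Sum>m\<in>monomials d. C m * q i j i 0 y 0 m)"
        using ij that by (intro dvd_diff Q) auto
      also have "\<dots> = (\<Sum>m\<in>monomials d. C m * ?E x y m)"
        by (simp add: sum_subtractf right_diff_distrib)
      also have "\<dots> = (\<Sum>m\<in>?S. C m * ?E x y m)"
        using mem other by (intro sum.mono_neutral_right) auto
      also have "\<dots> = C (Squarefree {i, j}) * ?E x y (Squarefree {i, j})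
        + (C (Mixed i j) * ?E x y (Mixed i j) + C (Mixed j i) * ?E x y (Mixed j i))"
        using ij by simp
      finally show ?thesis .
    qed
    \<comment> \<open>The points (1,1), (1,2), (2,1) give a 3 by 3 system of determinant -2,
      invertible modulo 3.\<close>
    have "3 dvd C (Mixed i j) + C (Mixed j i)"
      using main[of 1 1] ij by (simp add: q_def)
    moreover have "3 dvd C (Squarefree {i, j}) + C (Mixed i j)"
      using main[of 1 2] ij by (simp add: q_def)
    moreover have "3 dvd C (Squarefree {i, j}) + C (Mixed j i)"
      using main[of 2 1] ij by (simp add: q_def)
    moreover have "C (Squarefree {i, j}) \<in> {0, 1, 2}" "C (Mixed i j) \<in> {0, 1, 2}" "C (Mixed j i) \<in> {0, 1, 2}"
      using mem by (intro C; simp)+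
    ultimately show ?thesis by auto
  qed
  have single: "C (Squarefree {i}) = 0 \<and> C (Mixed i i) = 0 \<and> C (Square i) = 0" if i: "i < d" for i
  proof -
    let ?S = "{Squarefree {i}, Mixed i i, Square i}"
    have mem: "?S \<subseteq> monomials d" using i by (auto simp: monomials_def)
    have other: "C m * q i i i x 0 0 m = 0" if m: "m \<in> monomials d - ?S" for m x
    proof (cases m)
      case (Squarefree A)
      then have A: "A \<subseteq> {..<d}" "card A \<in> {1, 2, 3}" "A \<noteq> {i}" using m by (auto simp: monomials_def)
      show ?thesis
      proof (cases "i \<in> A")
        case True
        consider j where "A = {j}" | j k where "A = {j, k}" "j \<noteq> k"
          | j k l where "A = {j, k, l}" "j \<noteq> k" "j \<noteq> l" "k \<noteq> l"
          using A(2) by (auto simp: card_1_singleton_iff card_2_iff card_3_iff)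
        then have "C m = 0"
        proof cases
          case 1
          then show ?thesis using A(3) True by auto
        next
          case (2 j k)
          then show ?thesis using A(1) pair[of j k] Squarefree by auto
        next
          case (3 j k l)
          then show ?thesis using A(1) triple[of j k l] Squarefree by auto
        qed
        then show ?thesis by simp
      next
        case False
        then show ?thesis using Squarefree by (simp add: q_def)
      qed
    next
      case (Mixed p r)
      then have "p < d" "r < d" using m by (auto simp: monomials_def)
      then show ?thesis using m Mixed pair[of p r] by (cases "p = r") (auto simp: q_def)
    qed (use m in \<open>auto simp: q_def\<close>)
    have main: "3 dvd C (Squarefree {i}) * (x div 3) + (C (Mixed i i) * x + C (Square i) * ((2 * x) div 3))"
      if "0 \<le> x" "x \<le> 8" for x
    proof -
      have "3 dvd (\<Sum>m\<in>monomials d. C m * q i i i x 0 0 m)" using i that by (intro Q) auto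
      also have "\<dots> = (\<Sum>m\<in>?S. C m * q i i i x 0 0 m)"
        using mem other by (intro sum.mono_neutral_right) auto
      also have "\<dots> = C (Squarefree {i}) * (x div 3) + (C (Mixed i i) * x + C (Square i) * ((2 * x) div 3))"
        by (simp add: q_def mult.commute)
      finally show ?thesis .
    qed
    \<comment> \<open>The values 1, 2, 3 give a triangular system with unit diagonal, in the order
      \<open>Mixed\<close>, \<open>Square\<close>, \<open>Squarefree\<close>.\<close>
    have "3 dvd C (Mixed i i)" using main[of 1] by simp
    moreover have "3 dvd C (Mixed i i) * 2 + C (Square i)" using main[of 2] by simp
    moreover have "3 dvd C (Squarefree {i}) + (C (Mixed i i) * 3 + C (Square i) * 2)"
      using main[of 3] by simp
    moreover have "C (Squarefree {i}) \<in> {0, 1, 2}" "C (Mixed i i) \<in> {0, 1, 2}" "C (Square i) \<in> {0, 1, 2}"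
      using mem by (intro C; simp)+
    ultimately show ?thesis by auto
  qed
  show "C m = 0"
  proof (cases m)
    case (Squarefree A)
    then have A: "A \<subseteq> {..<d}" "card A \<in> {1, 2, 3}" using m by (auto simp: monomials_def)
    then show ?thesis
      using single pair triple Squarefree
      by (auto simp: card_1_singleton_iff card_2_iff card_3_iff)
  next
    case (Mixed p r)
    then have "p < d" "r < d" using m by (auto simp: monomials_def)
    then show ?thesis using Mixed single[of p] pair[of p r] by (cases "p = r") auto
  next
    case (Square i)
    then show ?thesis using single[of i] m by (auto simp: monomials_def)
  next
    case (Free i)
    then show ?thesis using m by (auto simp: monomials_def)
  qed
qed

subsection \<open>Codes of prescribed rank\<close>

lemma additive_code_hom_image:
  assumes sp: "f ` Z3Z9_space g d \<subseteq> Z3Z9_space a b"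
    and hom: "\<forall>u\<in>Z3Z9_space g d. \<forall>v\<in>Z3Z9_space g d. f (z39_add u v) = z39_add (f u) (f v)"
  shows "additive_code a b (f ` Z3Z9_space g d)"
  unfolding additive_code_def
proof (intro conjI ballI)
  have z: "f (z39_zero g d) = z39_zero a b"
    by (rule z39_hom_zero[OF additive_code_space sp hom])
  show "f ` Z3Z9_space g d \<subseteq> Z3Z9_space a b" by (fact sp)
  show "z39_zero a b \<in> f ` Z3Z9_space g d"
    using z z39_zero_in_space by (metis imageI)
  fix w assume "w \<in> f ` Z3Z9_space g d"
  then obtain u where u: "u \<in> Z3Z9_space g d" "w = f u" by blast
  then have w: "w \<in> Z3Z9_space a b" using sp by blast
  have n: "z39_neg u \<in> Z3Z9_space g d" using u by (simp add: z39_neg_in_space)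
  then have fn: "f (z39_neg u) \<in> Z3Z9_space a b" using sp by blast
  have fnw: "z39_add (f (z39_neg u)) w = z39_zero a b"
    using hom n u z39_add_neg[OF u(1)] z by metis
  have "f (z39_neg u) = z39_add (f (z39_neg u)) (z39_add w (z39_neg w))"
    using z39_add_neg[OF w] z39_add_zero[OF fn] by (simp add: z39_add_commute)
  also have "\<dots> = z39_neg w"
    using fnw z39_add_zero[OF z39_neg_in_space[OF w]] by (simp add: z39_add_assoc[symmetric])
  finally show "z39_neg w \<in> f ` Z3Z9_space g d" using n by (metis imageI)
  fix w' assume "w' \<in> f ` Z3Z9_space g d"
  then obtain u' where "u' \<in> Z3Z9_space g d" "w' = f u'" by blast
  then show "z39_add w w' \<in> f ` Z3Z9_space g d"
    using u hom z39_add_in_space by (metis imageI)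
qed

text \<open>Describes both the torsion projection and the possible high digits of the constructed
  code, whose coordinates past a certain point are 0.\<close>

definition padded :: "nat \<Rightarrow> nat \<Rightarrow> int list set" where
  "padded n p = (\<lambda>v. v @ replicate p 0) ` f3_vecs n"

lemma f3_add_append:
  "length v = length v' \<Longrightarrow> f3_add (v @ w) (v' @ w') = f3_add v v' @ f3_add w w'"
  by (simp add: f3_add_def)

lemma z9_add_append:
  "length v = length v' \<Longrightarrow> z9_add (v @ w) (v' @ w') = z9_add v v' @ z9_add w w'"
  by (simp add: z9_add_def)

lemma f3_subspace_padded: "f3_subspace (n + p) (padded n p)"
  unfolding f3_subspace_def
proof (intro conjI ballI)
  show "padded n p \<subseteq> f3_vecs (n + p)" by (auto simp: padded_def f3_vecs_iff_nth nth_append)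
  show "replicate (n + p) 0 \<in> padded n p"
    unfolding padded_def replicate_add by (rule imageI) (rule zero_in_f3_vecs)
  fix v w assume "v \<in> padded n p" "w \<in> padded n p"
  then obtain v' w' where "v = v' @ replicate p 0" "w = w' @ replicate p 0"
    "v' \<in> f3_vecs n" "w' \<in> f3_vecs n" by (auto simp: padded_def)
  moreover from this have "f3_add v w = f3_add v' w' @ replicate p 0"
    by (simp add: f3_add_append f3_vecs_iff_nth f3_add_zero[OF zero_in_f3_vecs])
  ultimately show "f3_add v w \<in> padded n p"
    unfolding padded_def using f3_add_in_vecs by blast
qed

lemma card_padded: "card (padded n p) = 3 ^ n"
  unfolding padded_def by (subst card_image) (auto simp: inj_on_def card_f3_vecs)

lemma sum_lessThan_add: "(\<Sum>n<p + q. h n) = (\<Sum>n<p. h n) + (\<Sum>n<q. h (p + n))"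
  for h :: "nat \<Rightarrow> int"
  by (induction q) (simp_all add: add.assoc)

text \<open>\<open>ms\<close> lists the appended forms. \<open>ms_new\<close> excludes \<mu>_i and 3
  \<mu>_i, whose high digits are the two digits of \<mu>_i and are present anyway. With r = g + 2 d
  + \<open>length ms\<close>, the condition \<open>ms_fit\<close> says exactly r \<le> b + d +
  k.\<close>

locale rank_code =
  fixes a b g d k :: nat and ms :: "monomial list"
  assumes k_le_a: "k \<le> a" and k_le_g: "k \<le> g"
    and ms_distinct: "distinct ms" and ms_sub: "set ms \<subseteq> monomials d"
    and ms_new: "\<And>i. Squarefree {i} \<notin> set ms" "\<And>i. Mixed i i \<notin> set ms"
    and ms_fit: "d + length ms + (g - k) \<le> b"
begin

definition t where "t = d + length ms + (g - k)"

text \<open>Since the torsion projection must have dimension \<open>k\<close>, only \<open>k\<close>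
  free parameters appear as ternary coordinates; the other g - k are placed modulo 9 as multiples of
  3. Zeros fill both parts to full length.\<close>

definition enc :: "int list \<times> int list \<Rightarrow> int list \<times> int list" where
  "enc = (\<lambda>(x, y). (take k x @ replicate (a - k) 0,
     (y @ map (\<lambda>m. form d m ((!) y) mod 9) ms @ map (\<lambda>s. 3 * s) (drop k x)) @ replicate (b - t) 0))"

abbreviation msgs where "msgs \<equiv> Z3Z9_space g d"

lemma enc_in_space: "u \<in> msgs \<Longrightarrow> enc u \<in> Z3Z9_space a b"
proof -
  assume u: "u \<in> msgs"
  obtain x y where xy: "u = (x, y)" by (cases u)
  have x: "length x = g" "set x \<subseteq> {0..2}" and y: "length y = d" "set y \<subseteq> {0..8}"
    using u by (auto simp: xy Z3Z9_space_def)
  have "set (take k x) \<subseteq> {0..2}" "set (drop k x) \<subseteq> {0..2}"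
    using x set_take_subset[of k x] set_drop_subset[of k x] by blast+
  moreover have "form d m ((!) y) mod 9 \<in> {0..8}" for m
    using pos_mod_bound[of 9 "form d m ((!) y)"] by (simp del: pos_mod_bound)
  ultimately show ?thesis
    using x y k_le_a k_le_g ms_fit by (auto simp: xy enc_def Z3Z9_space_def t_def)
qed

lemma enc_hom:
  assumes "u \<in> msgs" "v \<in> msgs"
  shows "enc (z39_add u v) = z39_add (enc u) (enc v)"
proof -
  obtain x y x' y' where uv: "u = (x, y)" "v = (x', y')" by (cases u, cases v)
  have x: "length x = g" "length x' = g" and y: "length y = d" "length y' = d"
    using assms by (auto simp: uv Z3Z9_space_def)
  have 1: "take k (f3_add x x') = f3_add (take k x) (take k x')"
    using x by (intro nth_equalityI) auto
  have 2: "map (\<lambda>m. form d m ((!) (z9_add y y')) mod 9) ms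
      = z9_add (map (\<lambda>m. form d m ((!) y) mod 9) ms) (map (\<lambda>m. form d m ((!) y') mod 9) ms)"
  proof (rule nth_equalityI)
    fix i assume "i < length (map (\<lambda>m. form d m ((!) (z9_add y y')) mod 9) ms)"
    then have i: "i < length ms" by simp
    have "[form d m ((!) (z9_add y y')) = form d m ((!) y) + form d m ((!) y')] (mod 9)" for m
    proof -
      have "[form d m ((!) (z9_add y y')) = (\<Sum>l<d. weight m l * (y ! l + y' ! l))] (mod 9)"
        unfolding form_def using y by (intro cong_sum cong_mult cong_refl) (auto simp: cong_def)
      then show ?thesis by (simp add: form_def distrib_left sum.distrib)
    qed
    then show "map (\<lambda>m. form d m ((!) (z9_add y y')) mod 9) ms ! i
        = z9_add (map (\<lambda>m. form d m ((!) y) mod 9) ms) (map (\<lambda>m. form d m ((!) y') mod 9) ms) ! i"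
      using i by (simp add: cong_def mod_simps)
  qed simp
  have 3: "map (\<lambda>s. 3 * s) (drop k (f3_add x x'))
      = z9_add (map (\<lambda>s. 3 * s) (drop k x)) (map (\<lambda>s. 3 * s) (drop k x'))"
  proof (rule nth_equalityI)
    have "3 * (s mod 3) = (3 * s) mod 9" for s :: int by (simp add: mult_mod_right)
    then show "map (\<lambda>s. 3 * s) (drop k (f3_add x x')) ! i
        = z9_add (map (\<lambda>s. 3 * s) (drop k x)) (map (\<lambda>s. 3 * s) (drop k x')) ! i"
      if "i < length (map (\<lambda>s. 3 * s) (drop k (f3_add x x')))" for i
      using that x k_le_g by (simp add: distrib_left)
  qed simp
  have 4: "z9_add (replicate n 0) (replicate n 0) = replicate n 0"
      "f3_add (replicate n 0) (replicate n 0) = replicate n 0" for n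
    by (rule nth_equalityI; simp)+
  have len: "length (take k x) = length (take k x')" "length y = length y'"
    "length (drop k x) = length (drop k x')"
    using x y by simp_all
  show ?thesis
    using len by (simp add: uv enc_def z39_add_Pair f3_add_append z9_add_append 1 2 3 4)
qed

lemma inj_on_enc: "inj_on enc msgs"
proof (rule inj_onI)
  fix u v assume "u \<in> msgs" "v \<in> msgs" and eq: "enc u = enc v"
  moreover obtain x y x' y' where uv: "u = (x, y)" "v = (x', y')" by (cases u, cases v)
  ultimately have x: "length x = g" "length x' = g" and y: "length y = d" "length y' = d"
    by (auto simp: Z3Z9_space_def)
  have tk: "take k x = take k x'" using eq by (simp add: uv enc_def)
  have "y = y'" and dr: "map (\<lambda>s. 3 * s) (drop k x) = map (\<lambda>s. 3 * s) (drop k x')"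
    using eq x y by (simp_all add: uv enc_def)
  moreover from dr have "drop k x = drop k x'"
    by (rule map_injective) (simp add: inj_def)
  ultimately show "u = v" using tk by (metis append_take_drop_id uv)
qed

section \<open>Type and rank of the constructed code\<close>

abbreviation code where "code \<equiv> enc ` msgs"

lemma additive_code: "additive_code a b code"
  using enc_in_space enc_hom by (intro additive_code_hom_image) auto

lemma fst_torsion_code: "fst ` torsion a b code = padded k (a - k)"
proof (rule antisym)
  show "fst ` torsion a b code \<subseteq> padded k (a - k)"
  proof
    fix v assume "v \<in> fst ` torsion a b code"
    then obtain x y where xy: "(x, y) \<in> msgs" "v = fst (enc (x, y))"
      unfolding torsion_def by auto
    then have "take k x \<in> f3_vecs k"
      using k_le_g by (auto simp: Z3Z9_space_iff_nth f3_vecs_iff_nth)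
    then show "v \<in> padded k (a - k)" using xy by (simp add: enc_def padded_def)
  qed
  show "padded k (a - k) \<subseteq> fst ` torsion a b code"
  proof
    fix v assume "v \<in> padded k (a - k)"
    then obtain w where w: "w \<in> f3_vecs k" "v = w @ replicate (a - k) 0" by (auto simp: padded_def)
    let ?u = "(w @ replicate (g - k) 0, replicate d (0::int))"
    have u: "?u \<in> msgs" using w k_le_g by (auto simp: Z3Z9_space_def f3_vecs_def)
    have "z39_add ?u (z39_add ?u ?u) = z39_zero g d"
      unfolding triple_z39_eq_zero_iff[OF u] by simp
    then have "z39_add (enc ?u) (z39_add (enc ?u) (enc ?u)) = enc (z39_zero g d)"
      using u enc_hom z39_add_in_space by metis
    also have "\<dots> = z39_zero a b"
      using enc_in_space enc_hom by (intro z39_hom_zero[OF additive_code_space]) auto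
    finally have "enc ?u \<in> torsion a b code" using u by (simp add: torsion_def)
    moreover have "fst (enc ?u) = v" using w by (simp add: enc_def f3_vecs_def)
    ultimately show "v \<in> fst ` torsion a b code" by (metis imageI)
  qed
qed

lemma code_type: "code_type a b g d k code"
  unfolding code_type_def
proof (intro conjI exI[of _ enc] ballI)
  show "additive_code a b code" by (rule additive_code)
  show "bij_betw enc msgs code" using inj_on_enc by (simp add: bij_betw_def)
  show "enc (z39_add u v) = z39_add (enc u) (enc v)" if "u \<in> msgs" "v \<in> msgs" for u v
    using that by (rule enc_hom)
  have "3 ^ f3_dim a (fst ` torsion a b code) = (3::nat) ^ k"
    using card_f3_subspace[OF f3_subspace_fst_torsion[OF additive_code]]
    by (simp add: fst_torsion_code card_padded)
  then show "f3_dim a {x. \<exists>y. (x, y) \<in> code \<and>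
      z39_add (x, y) (z39_add (x, y) (x, y)) = z39_zero a b} = k"
    by (simp add: fst_torsion_eq)
qed

text \<open>High digits occur only in the first \<open>t\<close> coordinates, so the bound by the
  length applies with \<open>t\<close> in place of \<open>b\<close>.\<close>

lemma code_rank_le: "code_rank a b code \<le> g + 2 * d + length ms"
proof -
  have "map (\<lambda>s. s div 3) y \<in> padded t (b - t)" if "(x, y) \<in> code" for x y
  proof -
    from that obtain u where u: "(x, y) = enc u" "u \<in> msgs" by (rule imageE)
    have sp: "(x, y) \<in> Z3Z9_space a b" unfolding u(1) by (rule enc_in_space[OF u(2)])
    obtain y' where y': "y = y' @ replicate (b - t) 0" "length y' = t"
      using u k_le_g by (cases u) (auto simp: enc_def t_def Z3Z9_space_def)
    have "map (\<lambda>s. s div 3) y' \<in> f3_vecs t"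
    proof -
      have "set y' \<subseteq> {0..8}" using sp y'(1) by (auto simp: Z3Z9_space_def)
      then have "s div 3 \<in> {0..2}" if "s \<in> set y'" for s using that by force
      then show ?thesis using y'(2) by (auto simp: f3_vecs_def)
    qed
    then show ?thesis by (simp add: y' padded_def)
  qed
  moreover have "t + (b - t) = b" using ms_fit by (simp add: t_def)
  ultimately have "3 ^ code_rank a b code \<le> 3 ^ (d + k) * card (padded t (b - t))"
    using f3_subspace_padded[of t "b - t"] by (intro code_rank_le_high_digits[OF code_type]) auto
  also have "\<dots> = 3 ^ (d + k + t)" by (simp add: card_padded power_add)
  finally show ?thesis using k_le_g by (simp add: t_def)
qed

text \<open>All forms whose high digits occur among the digits of the code. The order is that of
  \<open>proj\<close>: low digits of \<mu>, high digits of \<mu>, then the appended forms.\<close>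

definition L where "L = map (\<lambda>i. Mixed i i) [0..<d] @ map (\<lambda>i. Squarefree {i}) [0..<d] @ ms"

lemma distinct_L: "distinct L"
  using ms_distinct ms_new by (auto simp: L_def distinct_map inj_on_def)

lemma set_L: "set L \<subseteq> monomials d"
  using ms_sub by (auto simp: L_def monomials_def)

lemma length_L: "length L = 2 * d + length ms"
  by (simp add: L_def)

text \<open>Keeps the k + d + t digit coordinates that will turn out to be independent.\<close>

definition proj :: "int list \<times> int list \<times> int list \<Rightarrow> int list" where
  "proj = (\<lambda>(x, y, z). take k x @ take d y @ take t z)"

definition row :: "int list \<Rightarrow> int list \<Rightarrow> int list" where
  "row x y = take k x @ map (\<lambda>m. (form d m ((!) y) div 3) mod 3) L @ drop k x"

lemma proj_digits_enc:
  assumes "(x, y) \<in> msgs"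
  shows "proj (digits (enc (x, y))) = row x y"
proof -
  have x: "length x = g" and y: "length y = d" "\<And>i. i < d \<Longrightarrow> 0 \<le> y ! i \<and> y ! i < 9"
    using assms by (auto simp: Z3Z9_space_iff_nth)
  have div_mod_9: "(s mod 9) div 3 = (s div 3) mod 3" for s :: int
    using zmod_zmult2_eq[of 3 s 3] by simp
  have "map (\<lambda>s. s mod 3) y = map (\<lambda>m. (form d m ((!) y) div 3) mod 3) (map (\<lambda>i. Mixed i i) [0..<d])"
  proof (rule nth_equalityI)
    fix i assume "i < length (map (\<lambda>s. s mod 3) y)"
    then have i: "i < d" using y by simp
    have "form d (Mixed i i) ((!) y) = (\<Sum>l<d. if l = i then 3 * y ! l else 0)"
      unfolding form_def by (intro sum.cong) auto
    then have "form d (Mixed i i) ((!) y) = 3 * y ! i" using i by simp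
    then show "map (\<lambda>s. s mod 3) y ! i
        = map (\<lambda>m. (form d m ((!) y) div 3) mod 3) (map (\<lambda>i. Mixed i i) [0..<d]) ! i"
      using i y by simp
  qed (use y in simp)
  moreover have "map (\<lambda>s. s div 3) y
      = map (\<lambda>m. (form d m ((!) y) div 3) mod 3) (map (\<lambda>i. Squarefree {i}) [0..<d])"
  proof (rule nth_equalityI)
    fix i assume "i < length (map (\<lambda>s. s div 3) y)"
    then have i: "i < d" using y by simp
    have "form d (Squarefree {i}) ((!) y) = (\<Sum>l<d. if l = i then y ! l else 0)"
      unfolding form_def by (intro sum.cong) auto
    then have "form d (Squarefree {i}) ((!) y) = y ! i" using i by simp
    then show "map (\<lambda>s. s div 3) y ! i
        = map (\<lambda>m. (form d m ((!) y) div 3) mod 3) (map (\<lambda>i. Squarefree {i}) [0..<d]) ! i"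
      using i y(1) y(2)[OF i] div_mod_9[of "y ! i"] by simp
  qed (use y in simp)
  ultimately show ?thesis
    using x y k_le_g
    by (simp add: proj_def digits_def enc_def row_def L_def t_def comp_def div_mod_9 min_def)
qed

text \<open>Messages with a single nonzero free parameter isolate the outer coefficients; messages
  without free parameters leave a relation between high digits of forms, excluded by
  \<open>forms_div_3_independent\<close>.\<close>

lemma row_annihilator:
  assumes c: "c \<in> f3_vecs (k + (length L + (g - k)))"
    and ann: "\<And>x y. (x, y) \<in> msgs \<Longrightarrow> 3 dvd (\<Sum>i<k + (length L + (g - k)). c ! i * row x y ! i)"
  shows "c = replicate (k + (length L + (g - k))) 0"
proof -
  let ?l = "length L"
  let ?q = "\<lambda>y m. form d m ((!) y) div 3"
  have cb: "c ! i \<in> {0, 1, 2}" if "i < k + (?l + (g - k))" for i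
  proof -
    have "0 \<le> c ! i" "c ! i < 3" using c that by (auto simp: f3_vecs_iff_nth)
    then show ?thesis by auto
  qed
  have c0: "c ! i = 0" if "i < k + (?l + (g - k))" "3 dvd c ! i" for i
    using cb[OF that(1)] that(2) by auto
  have split: "3 dvd (\<Sum>n<k. c ! n * x ! n) + ((\<Sum>n<?l. c ! (k + n) * (?q y (L ! n) mod 3))
      + (\<Sum>n<g - k. c ! (k + (?l + n)) * x ! (k + n)))"
    if xy: "(x, y) \<in> msgs" for x y
  proof -
    have x: "length x = g" using xy by (simp add: Z3Z9_space_def)
    have "(\<Sum>n<k. c ! n * row x y ! n) = (\<Sum>n<k. c ! n * x ! n)"
      using x k_le_g by (intro sum.cong) (auto simp: row_def nth_append)
    moreover have "(\<Sum>n<?l. c ! (k + n) * row x y ! (k + n)) = (\<Sum>n<?l. c ! (k + n) * (?q y (L ! n) mod 3))"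
      using x k_le_g by (intro sum.cong) (auto simp: row_def nth_append)
    moreover have "(\<Sum>n<g - k. c ! (k + (?l + n)) * row x y ! (k + (?l + n)))
        = (\<Sum>n<g - k. c ! (k + (?l + n)) * x ! (k + n))"
      using x k_le_g by (intro sum.cong) (auto simp: row_def nth_append)
    ultimately show ?thesis using ann[OF xy] by (simp add: sum_lessThan_add)
  qed
  have outer: "3 dvd (\<Sum>n<k. c ! n * of_bool (n = i)) + (\<Sum>n<g - k. c ! (k + (?l + n)) * of_bool (k + n = i))"
    if i: "i < g" for i
  proof -
    let ?x = "map (\<lambda>n. of_bool (n = i)) [0..<g]" and ?y = "replicate d (0::int)"
    have "(?x, ?y) \<in> msgs" by (simp add: Z3Z9_space_iff_nth)
    note split[OF this]
    moreover have "?q ?y m = 0" for m by (simp add: form_def)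
    moreover have "(\<Sum>n<k. c ! n * ?x ! n) = (\<Sum>n<k. c ! n * of_bool (n = i))"
      using k_le_g by (intro sum.cong) auto
    moreover have "(\<Sum>n<g - k. c ! (k + (?l + n)) * ?x ! (k + n))
        = (\<Sum>n<g - k. c ! (k + (?l + n)) * of_bool (k + n = i))"
      using k_le_g by (intro sum.cong) auto
    ultimately show ?thesis by simp
  qed
  have delta: "(\<Sum>n<p. h n * of_bool (n = i)) = h i" if "i < p" for h :: "nat \<Rightarrow> int" and i p
    using that by (simp add: of_bool_def if_distrib cong: if_cong)
  have left: "c ! i = 0" if i: "i < k" for i
  proof -
    have "(\<Sum>n<g - k. c ! (k + (?l + n)) * of_bool (k + n = i)) = 0"
      using i by (intro sum.neutral) auto
    then show ?thesis
      using outer[of i] i k_le_g delta[OF i, of "(!) c"] by (intro c0) auto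
  qed
  have right: "c ! (k + (?l + i)) = 0" if i: "i < g - k" for i
  proof -
    have "(\<Sum>n<k. c ! n * of_bool (n = k + i)) = 0"
      by (intro sum.neutral) auto
    then show ?thesis
      using outer[of "k + i"] i delta[OF i, of "\<lambda>n. c ! (k + (?l + n))"] by (intro c0) auto
  qed
  have middle: "c ! (k + i) = 0" if i: "i < ?l" for i
  proof -
    have bij: "bij_betw ((!) L) {..<?l} (set L)" by (rule bij_betw_nth[OF distinct_L]) auto
    \<comment> \<open>Moves the coefficients from positions in \<open>L\<close> to monomials. The
      default 0 extends the relation to all of \<open>monomials d\<close>.\<close>
    define C where "C = (\<lambda>m. if m \<in> set L then c ! (k + inv_into {..<?l} ((!) L) m) else 0)"
    have C_nth: "C (L ! n) = c ! (k + n)" if "n < ?l" for n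
      using that bij by (simp add: C_def bij_betw_def inv_into_f_f)
    have "C (L ! i) = 0"
    proof (rule forms_div_3_independent[where d = d])
      show "L ! i \<in> monomials d" using set_L i by auto
      show "C m \<in> {0, 1, 2}" for m
      proof (cases "m \<in> set L")
        case True
        then obtain n where "n < ?l" "m = L ! n" by (metis in_set_conv_nth)
        then show ?thesis using C_nth cb[of "k + n"] by simp
      qed (simp add: C_def)
      fix \<mu> :: "nat \<Rightarrow> int" assume \<mu>: "\<And>l. \<mu> l \<in> {0..8}"
      let ?x = "replicate g (0::int)" and ?y = "map \<mu> [0..<d]"
      have form: "form d m ((!) ?y) = form d m \<mu>" for m
        unfolding form_def by (intro sum.cong) auto
      have "(?x, ?y) \<in> msgs" using \<mu> by (auto simp: Z3Z9_space_def)
      from split[OF this] have "3 dvd (\<Sum>n<?l. c ! (k + n) * ((form d (L ! n) \<mu> div 3) mod 3))"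
        using k_le_g by (simp add: form)
      moreover have "[(\<Sum>n<?l. c ! (k + n) * ((form d (L ! n) \<mu> div 3) mod 3))
          = (\<Sum>n<?l. c ! (k + n) * (form d (L ! n) \<mu> div 3))] (mod 3)"
        by (intro cong_sum cong_mult cong_mod_leftI cong_refl)
      ultimately have "3 dvd (\<Sum>n<?l. c ! (k + n) * (form d (L ! n) \<mu> div 3))"
        by (simp add: cong_dvd_iff)
      also have "\<dots> = (\<Sum>n<?l. C (L ! n) * (form d (L ! n) \<mu> div 3))"
        by (intro sum.cong) (auto simp: C_nth)
      also have "\<dots> = (\<Sum>m\<in>set L. C m * (form d m \<mu> div 3))"
        by (rule sum.reindex_bij_betw[OF bij])
      also have "\<dots> = (\<Sum>m\<in>monomials d. C m * (form d m \<mu> div 3))"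
        using set_L by (intro sum.mono_neutral_left) (auto simp: C_def)
      finally show "3 dvd (\<Sum>m\<in>monomials d. C m * (form d m \<mu> div 3))" .
    qed
    then show ?thesis using C_nth[OF i] by simp
  qed
  show ?thesis
  proof (rule nth_equalityI)
    show len: "length c = length (replicate (k + (?l + (g - k))) (0::int))"
      using c by (simp add: f3_vecs_iff_nth)
    fix i assume "i < length c"
    then have i: "i < k + (?l + (g - k))" using len by simp
    consider "i < k" | n where "n < ?l" "i = k + n" | n where "n < g - k" "i = k + (?l + n)"
    proof -
      have "i < k \<or> i - k < ?l \<and> i = k + (i - k) \<or> i - k - ?l < g - k \<and> i = k + (?l + (i - k - ?l))"
        using i by linarith
      then show thesis using that by blast
    qed
    then have "c ! i = 0" using left right middle by cases auto
    then show "c ! i = replicate (k + (?l + (g - k))) 0 ! i" using i by simp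
  qed
qed

text \<open>Any subspace of triples containing the digits projects to a subspace with trivial
  annihilator, hence onto the whole space, so it has at least 3^(k + d + t) elements.\<close>

lemma code_rank_ge: "g + 2 * d + length ms \<le> code_rank a b code"
proof -
  let ?r = "k + (length L + (g - k))"
  have sp: "code \<subseteq> Z3Z9_space a b" using enc_in_space by auto
  obtain T where T: "triple_subspace a b T" "digits ` code \<subseteq> T" "card T \<le> 3 ^ code_rank a b code"
    using code_rank_lower[OF sp] .
  have Tn: "T \<subseteq> triples a b" using T(1) by (simp add: triple_subspace_def)
  have r: "?r = k + (d + t)" by (simp add: length_L t_def)
  have dt: "d \<le> b" "t \<le> b" using ms_fit by (auto simp: t_def)
  have take_vecs: "take n v \<in> f3_vecs n" if "v \<in> f3_vecs p" "n \<le> p" for n p v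
    using that by (auto simp: f3_vecs_iff_nth)
  have take_add: "take n (f3_add v w) = f3_add (take n v) (take n w)" for n v w
    by (simp add: f3_add_def take_map take_zip)
  have "f3_subspace ?r (proj ` T)"
    unfolding f3_subspace_def
  proof (intro conjI ballI)
    show "proj ` T \<subseteq> f3_vecs ?r"
    proof (rule image_subsetI)
      fix s assume "s \<in> T"
      then obtain x y z where s: "s = (x, y, z)" "x \<in> f3_vecs a" "y \<in> f3_vecs b" "z \<in> f3_vecs b"
        using Tn by (auto simp: triples_def)
      then have "take k x \<in> f3_vecs k" "take d y \<in> f3_vecs d" "take t z \<in> f3_vecs t"
        using take_vecs k_le_a dt by blast+
      then show "proj s \<in> f3_vecs ?r" unfolding r by (auto simp: s proj_def f3_vecs_def)
    qed
    have "proj (replicate a 0, replicate b 0, replicate b 0) = replicate ?r 0"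
      unfolding r using k_le_a dt by (simp add: proj_def replicate_add)
    then show "replicate ?r 0 \<in> proj ` T"
      using T(1) by (metis triple_subspace_def imageI)
    fix v w assume "v \<in> proj ` T" "w \<in> proj ` T"
    then obtain s s' where s: "s \<in> T" "s' \<in> T" "v = proj s" "w = proj s'" by blast
    obtain x y z x' y' z' where xyz: "s = (x, y, z)" "s' = (x', y', z')" by (cases s, cases s')
    have "length x = length x'" "length y = length y'"
      using s Tn by (auto simp: xyz triples_def f3_vecs_def)
    then have "f3_add v w = proj (triple_add s s')"
      by (simp add: s xyz proj_def triple_add_def f3_add_append take_add)
    then show "f3_add v w \<in> proj ` T" using T(1) s by (auto simp: triple_subspace_def)
  qed
  moreover have "c = replicate ?r 0"
    if c: "c \<in> f3_vecs ?r" and ann: "\<And>v. v \<in> proj ` T \<Longrightarrow> 3 dvd (\<Sum>i<?r. c ! i * v ! i)" for c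
  proof (rule row_annihilator[OF c])
    fix x y assume xy: "(x, y) \<in> msgs"
    then have "digits (enc (x, y)) \<in> T" using T(2) by blast
    then have "row x y \<in> proj ` T" using proj_digits_enc[OF xy] by (metis imageI)
    then show "3 dvd (\<Sum>i<?r. c ! i * row x y ! i)" by (rule ann)
  qed
  ultimately have "proj ` T = f3_vecs ?r" by (rule f3_subspace_eq_vecs)
  then have "3 ^ ?r = card (proj ` T)" by (simp add: card_f3_vecs)
  also have "\<dots> \<le> card T"
    using finite_subset[OF Tn] by (intro card_image_le) simp
  also note T(3)
  finally show ?thesis using k_le_g by (simp add: length_L)
qed

end

section \<open>The two directions of the equivalence\<close>

theorem theorem6:
  fixes a b g d k r :: nat
  assumes "0 < a" "0 < b" "0 < g" "0 < d" "0 < k"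
    and "0 < g + d" "g + d \<le> b + k" "k \<le> min a g"
  shows "(\<exists>C. additive_code a b C \<and> code_type a b g d k C \<and> code_rank a b C = r) \<longleftrightarrow>
         r \<in> {g + 2 * d .. min (b + d + k) (g + d + ((d + 1) choose 2) + ((d + 2) choose 3))}"
    (is "?L \<longleftrightarrow> ?R")
proof
  assume ?L
  then obtain C where C: "additive_code a b C" and type: "code_type a b g d k C"
    and r: "code_rank a b C = r" by blast
  have sp: "C \<subseteq> Z3Z9_space a b" using C by (simp add: additive_code_def)
  have "(3::nat) ^ (g + 2 * d) \<le> 3 ^ r"
    using card_code_le_rank[OF sp] code_type_card(1)[OF type] r by simp
  then have lower: "g + 2 * d \<le> r" by simp
  have "map (\<lambda>t. t div 3) y \<in> f3_vecs b" if "(x, y) \<in> C" for x y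
    using digits_in_triples[of "(x, y)" a b] sp that by (auto simp: digits_def triples_def)
  \<comment> \<open>Here no restriction is placed on the high digits: \<open>Z\<close> is the full
    space of dimension \<open>b\<close>.\<close>
  then have "3 ^ r \<le> 3 ^ (d + k) * card (f3_vecs b)"
    using code_rank_le_high_digits[OF type f3_subspace_vecs] r by blast
  then have "(3::nat) ^ r \<le> 3 ^ (d + k + b)" by (simp add: card_f3_vecs power_add)
  then have "r \<le> b + d + k" by simp
  then show ?R using lower code_rank_le_monomials[OF type] r by simp
next
  assume R: ?R
  define n where "n = r - (g + 2 * d)"
  \<comment> \<open>The 2 d forms whose high digits are already the digits of \<mu>. As g +
    \<open>card (monomials d)\<close> is the cubic bound, exactly the admissible \<open>r\<close>
    leave enough forms outside \<open>?B\<close>.\<close>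
  let ?B = "(\<lambda>i. Mixed i i) ` {..<d} \<union> (\<lambda>i. Squarefree {i}) ` {..<d}"
  have "?B \<subseteq> monomials d" by (auto simp: monomials_def)
  moreover have "card ?B = d + d"
    by (subst card_Un_disjoint) (auto simp: card_image inj_on_def)
  ultimately have "card (monomials d - ?B) = card (monomials d) - (d + d)"
    by (subst card_Diff_subset) auto
  then have "n \<le> card (monomials d - ?B)"
    using R unfolding n_def card_monomials atLeastAtMost_iff min.bounded_iff by linarith
  then obtain M where M: "M \<subseteq> monomials d - ?B" "card M = n"
    by (meson obtain_subset_with_card_n)
  have "finite M" using M(1) finite_subset[of M "monomials d"] by auto
  then obtain ms where ms: "set ms = M" "distinct ms" using finite_distinct_list by blast
  have len: "length ms = n" using ms M(2) distinct_card[of ms] by simp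
  interpret rank_code a b g d k ms
  proof
    show "k \<le> a" "k \<le> g" using assms(8) by auto
    show "distinct ms" by (fact ms)
    show "set ms \<subseteq> monomials d" using ms M by auto
    show "Squarefree {i} \<notin> set ms" for i using ms M by (auto simp: monomials_def)
    show "Mixed i i \<notin> set ms" for i using ms M by (auto simp: monomials_def)
    show "d + length ms + (g - k) \<le> b" using R assms(7,8) by (auto simp: len n_def)
  qed
  have "code_rank a b code = r"
    using code_rank_le code_rank_ge R by (simp add: len n_def)
  then show ?L using additive_code code_type by blast
qed

end
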